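(* Let $\mathfrak g$ be an exponential solvable real Lie algebra, $f\in\mathfrak g^*$, and $\mathfrak h$ a real polarization at $f$. Let $d$ be the dimension of the coadjoint orbit of $f$ and let $K\subset\mathbb R^{d/2}$ be a compact set with non-empty interior. Let $\pi_\nu$ be the representation of the deformed algebra $\mathcal A$ in the topologically free convergent module $C_K^\infty(\mathbb R^{d/2})[[\nu]]$ constructed from these data (see context). Then $$V(\pi_\nu)=f+\mathfrak h^\perp.$$ In particular, if $\mathfrak h$ satisfies the Pukanszky condition $H.f=f+\mathfrak h^\perp$ (with $H=\exp\mathfrak h$), then $V(\pi_\nu)=H.f$.
   Context: Deformed algebra. $\mathcal A=S(\mathfrak g^{\mathbb C})[[\nu]]$ with product $u*v=\tau^{-1}(\tau u\cdot\tau v)$, where $\tau=\sigma\circ J(D)^{1/2}:\mathcal A\to\mathcal U_\nu(\mathfrak g^{\mathbb C})=T(\mathfrak g^{\mathbb C})[[\nu]]/\langle x\otimes y-y\otimes x-\nu[x,y]\rangle$ is the Duflo isomorphism ($\sigma$ symmetrization, $J(D)^{1/2}$ the constant-coefficient infinite-order differential operator with symbol $\det\big(\frac{\sinh(\mathrm{ad}\frac\nu2x)}{\mathrm{ad}\frac\nu2x}\big)^{1/2}$). Orbit data. $G$ is the connected simply connected Lie group of $\mathfrak g$ (exponential: $\exp$ is a diffeomorphism), $H=\exp\mathfrak h$, $O_f=G.f$ the coadjoint orbit with its symplectic Poisson bracket, the restriction of $\{\varphi,\psi\}(\eta)=\langle\eta,[d\varphi(\eta),d\psi(\eta)]\rangle$.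 A real polarization at $f$ is a subalgebra $\mathfrak h$ with $\langle f,[\mathfrak h,\mathfrak h]\rangle=0$ and $\dim\mathfrak h=\frac12(\dim\mathfrak g+\dim\mathfrak g_f)$, $\mathfrak g_f$ the stabilizer of $f$. $\mathfrak h^\perp$ is the annihilator of $\mathfrak h$ in $\mathfrak g^*$. Let $\mathrm{pr}:O_f\to G/H$, $g.f\mapsto gH$. Let $\mathcal E^0(O_f)=\{\psi\circ\mathrm{pr}:\psi\in C^\infty(G/H)\}$ and $\mathcal E^1(O_f)$ its normalizer in $C^\infty(O_f)$ for the Poisson bracket. Choose $X_1,\dots,X_{d/2}$ a coexponential basis of $\mathfrak h$ in $\mathfrak g$, so that $(x_1,\dots,x_{d/2})\mapsto\exp(x_1X_1)\cdots\exp(x_{d/2}X_{d/2})H$ is a diffeomorphism $\mathbb R^{d/2}\to G/H$, with inverse $\tau'=(\tau'_1,\dots,\tau'_{d/2})$, and put $q_j=\tau'_j\circ\mathrm{pr}$. By Pedersen there exist $p_1,\dots,p_{d/2}\in\mathcal E^1(O_f)$ such that $(p,q)$ is a global Darboux chart $O_f\to W_f\times\mathbb R^{d/2}$ with $W_f$ open in $\mathbb R^{d/2}$ and $\{p_i,p_j\}=\{q_i,q_j\}=0$, $\{p_i,q_j\}=\delta_{ij}$; and each $X\in\mathfrak g$, viewed as a linear function restricted to $O_f$, reads $X(p,q)=\sum_{u=1}^{d/2}a_{X,u}(q)p_u+a_{X,0}(q)$ with $a_{X,u}$ (restrictions to $\mathbb R^{d/2}$ of) entire functions. The representation. $C_K^\infty(\mathbb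 R^{d/2})$ is the space of complex-valued smooth functions on $\mathbb R^{d/2}$ supported in $K$. For $X\in\mathfrak g$ and $\xi\in C_K^\infty(\mathbb R^{d/2})$, $$\pi_\nu(X)\xi(t)=\sum_{u=1}^{d/2}i\,a_{X,u}(-i\nu t)\frac{\partial\xi}{\partial t_u}(t)+a_{X,0}(-i\nu t)\xi(t)+\frac\nu2\sum_{u=1}^{d/2}\frac{\partial a_{X,u}}{\partial t_u}(-i\nu t)\,\xi(t),$$ expanded as a formal power series in $\nu$; these operators satisfy $[\pi_\nu(X),\pi_\nu(Y)]=\nu\,\pi_\nu([X,Y])$ and so define a representation of $\mathcal U_\nu(\mathfrak g^{\mathbb C})\simeq(\mathcal A,* )$ in $C_K^\infty(\mathbb R^{d/2})[[\nu]]$. Characteristic variety. For an $\mathcal A$-module $\mathcal M$, $V(\mathcal M)=V(\pi_\nu)$ is the set of common zeros of the annihilator in $S(\mathfrak g^{\mathbb C})=\mathcal A/\nu\mathcal A$ of the module $\mathcal M/\nu\mathcal M$. For this module the variety is defined by polynomials with real coefficients, and $V(\pi_\nu)$ is identified with its set of real points, in $\mathfrak g^*$. *)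

theory Defs
  imports
    "HOL-Analysis.Analysis"
    "HOL-Library.Poly_Mapping"
    "HOL-Computational_Algebra.Formal_Power_Series"
begin

section \<open>Smooth functions\<close>

fun diff_times :: "nat \<Rightarrow> ('a::real_normed_vector \<Rightarrow> 'b::real_normed_vector) \<Rightarrow> bool" where
  "diff_times 0 F \<longleftrightarrow> continuous_on UNIV F"
| "diff_times (Suc k) F \<longleftrightarrow> (\<forall>x. F differentiable (at x)) \<and>
     (\<forall>v. diff_times k (\<lambda>x. frechet_derivative F (at x) v))"

definition smooth :: "('a::real_normed_vector \<Rightarrow> 'b::real_normed_vector) \<Rightarrow> bool" where
  "smooth F \<longleftrightarrow> (\<forall>k. diff_times k F)"

text \<open>
  The space of dimension \<open>m = d/2\<close> is the library's \<open>Euclidean_space m\<close>: functions on the naturals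
  vanishing from \<open>m\<close> on. In contrast to a finite index type, this allows \<open>m = 0\<close>, which occurs when
  \<open>f\<close> is a character. All indices \<open>1, ..., m\<close> are shifted to \<open>0, ..., m - 1\<close>.
\<close>

abbreviation Rm :: "nat \<Rightarrow> (nat \<Rightarrow> real) set" where
  "Rm m \<equiv> topspace (Euclidean_space m)"

definition Cm :: "nat \<Rightarrow> (nat \<Rightarrow> complex) set" where
  "Cm m = {z. \<forall>i\<ge>m. z i = 0}"

definition pdiff :: "nat \<Rightarrow> ((nat \<Rightarrow> real) \<Rightarrow> 'b::real_normed_vector) \<Rightarrow> (nat \<Rightarrow> real) \<Rightarrow> 'b" where
  "pdiff i F x = vector_derivative (\<lambda>s. F (x(i := s))) (at (x i))"

fun ck_on :: "nat \<Rightarrow> nat \<Rightarrow> (nat \<Rightarrow> real) set \<Rightarrow> ((nat \<Rightarrow> real) \<Rightarrow> 'b::real_normed_vector) \<Rightarrow> bool" where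
  "ck_on m 0 U F \<longleftrightarrow> continuous_on U F"
| "ck_on m (Suc k) U F \<longleftrightarrow> continuous_on U F \<and>
     (\<forall>i<m. (\<forall>x\<in>U. (\<lambda>s. F (x(i := s))) differentiable (at (x i))) \<and> ck_on m k U (pdiff i F))"

definition smooth_on :: "nat \<Rightarrow> (nat \<Rightarrow> real) set \<Rightarrow> ((nat \<Rightarrow> real) \<Rightarrow> 'b::real_normed_vector) \<Rightarrow> bool" where
  "smooth_on m U F \<longleftrightarrow> (\<forall>k. ck_on m k U F)"

definition CK :: "nat \<Rightarrow> (nat \<Rightarrow> real) set \<Rightarrow> ((nat \<Rightarrow> real) \<Rightarrow> complex) set" where
  "CK m K = {\<xi>. smooth_on m (Rm m) \<xi> \<and> (\<forall>t. t \<notin> K \<longrightarrow> \<xi> t = 0)}"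

definition entire :: "nat \<Rightarrow> ((nat \<Rightarrow> complex) \<Rightarrow> complex) \<Rightarrow> bool" where
  "entire m F \<longleftrightarrow> continuous_on (Cm m) F \<and>
     (\<forall>z\<in>Cm m. \<forall>i<m. (\<lambda>w. F (z(i := w))) holomorphic_on UNIV)"

definition cpdiff :: "nat \<Rightarrow> ((nat \<Rightarrow> complex) \<Rightarrow> complex) \<Rightarrow> (nat \<Rightarrow> complex) \<Rightarrow> complex" where
  "cpdiff i F z = deriv (\<lambda>w. F (z(i := w))) (z i)"


section \<open>Exponential solvable Lie algebras\<close>

type_synonym 'n vec = "real ^ 'n"
type_synonym 'n dual = "(real ^ 'n) \<Rightarrow>\<^sub>L real"
type_synonym 'n bracket = "real ^ 'n \<Rightarrow> real ^ 'n \<Rightarrow> real ^ 'n"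
type_synonym 'n grp = "real ^ 'n \<Rightarrow> real ^ 'n \<Rightarrow> real ^ 'n"

definition lie_algebra :: "'n::finite bracket \<Rightarrow> bool" where
  "lie_algebra br \<longleftrightarrow> bilinear br \<and> (\<forall>x. br x x = 0) \<and>
     (\<forall>x y z. br x (br y z) + br y (br z x) + br z (br x y) = 0)"

fun derived_alg :: "'n::finite bracket \<Rightarrow> nat \<Rightarrow> 'n vec set" where
  "derived_alg br 0 = UNIV"
| "derived_alg br (Suc k) = span {br x y | x y. x \<in> derived_alg br k \<and> y \<in> derived_alg br k}"

definition solvable_lie :: "'n::finite bracket \<Rightarrow> bool" where
  "solvable_lie br \<longleftrightarrow> (\<exists>k. derived_alg br k = {0})"

definition Ad :: "'n::finite grp \<Rightarrow> 'n vec \<Rightarrow> 'n vec \<Rightarrow> 'n vec" where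
  "Ad mul x y = vector_derivative (\<lambda>t. mul (mul x (t *\<^sub>R y)) (- x)) (at 0)"

text \<open>
  Exponentiality means that \<open>exp\<close> is a diffeomorphism from the Lie algebra onto the connected simply
  connected group \<open>G\<close>. The group law \<open>mul\<close> below is that of \<open>G\<close> transported along \<open>exp\<close> to the
  vector space of the Lie algebra. In these coordinates \<open>exp\<close> is the identity map: the
  one-parameter groups are the lines \<open>t *\<^sub>R x\<close>, the inverse of \<open>x\<close> is \<open>- x\<close>, and a subalgebra \<open>h\<close>,
  viewed as a subset, is its own group \<open>exp h\<close>. Conversely a group law of this kind exhibits \<open>G\<close>,
  with \<open>exp\<close> a diffeomorphism. The last clause says that the Lie algebra of this group is the given
  one: \<open>ad\<close> is the derivative of \<open>Ad\<close>.
\<close>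

definition exp_group :: "'n::finite bracket \<Rightarrow> 'n grp \<Rightarrow> bool" where
  "exp_group br mul \<longleftrightarrow>
     smooth (\<lambda>z. mul (fst z) (snd z)) \<and>
     (\<forall>x y z. mul (mul x y) z = mul x (mul y z)) \<and>
     (\<forall>x. mul 0 x = x \<and> mul x 0 = x \<and> mul x (- x) = 0 \<and> mul (- x) x = 0) \<and>
     (\<forall>x s t. mul (s *\<^sub>R x) (t *\<^sub>R x) = (s + t) *\<^sub>R x) \<and>
     (\<forall>x y. ((\<lambda>s. Ad mul (s *\<^sub>R x) y) has_vector_derivative br x y) (at 0))"

definition exponential_solvable :: "'n::finite bracket \<Rightarrow> 'n grp \<Rightarrow> bool" where
  "exponential_solvable br mul \<longleftrightarrow> lie_algebra br \<and> solvable_lie br \<and> exp_group br mul"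


section \<open>Coadjoint orbits and polarizations\<close>

definition coad :: "'n::finite grp \<Rightarrow> 'n vec \<Rightarrow> 'n dual \<Rightarrow> 'n dual" where
  "coad mul x \<eta> = \<eta> o\<^sub>L Blinfun (Ad mul (- x))"

definition coad_orbit :: "'n::finite grp \<Rightarrow> 'n dual \<Rightarrow> 'n dual set" where
  "coad_orbit mul f = range (\<lambda>x. coad mul x f)"

text \<open>The dimension of the tangent space of the orbit at \<open>f\<close>.\<close>

definition orbit_dim :: "'n::finite bracket \<Rightarrow> 'n dual \<Rightarrow> nat" where
  "orbit_dim br f = dim (range (\<lambda>x. f o\<^sub>L Blinfun (br x)))"

definition stabilizer :: "'n::finite bracket \<Rightarrow> 'n dual \<Rightarrow> 'n vec set" where
  "stabilizer br f = {x. \<forall>y. f (br x y) = 0}"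

definition real_polarization :: "'n::finite bracket \<Rightarrow> 'n dual \<Rightarrow> 'n vec set \<Rightarrow> bool" where
  "real_polarization br f h \<longleftrightarrow> subspace h \<and> (\<forall>x\<in>h. \<forall>y\<in>h. br x y \<in> h) \<and>
     (\<forall>x\<in>h. \<forall>y\<in>h. f (br x y) = 0) \<and>
     2 * dim h = dim (UNIV :: 'n vec set) + dim (stabilizer br f)"

definition annih :: "'n::finite vec set \<Rightarrow> 'n dual set" where
  "annih h = {\<eta> :: 'n dual. \<forall>x\<in>h. \<eta> x = 0}"

text \<open>
  The orbit carries the manifold structure of the homogeneous space \<open>G/G_f\<close>; a function on the orbit
  is represented by a function on the dual of which only the values on the orbit matter.
\<close>

definition orbit_smooth :: "'n::finite grp \<Rightarrow> 'n dual \<Rightarrow> ('n dual \<Rightarrow> real) \<Rightarrow> bool" where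
  "orbit_smooth mul f \<phi> \<longleftrightarrow> smooth (\<lambda>x. \<phi> (coad mul x f))"

text \<open>
  \<open>is_diff\<close>: the vector \<open>x\<close>, as a linear function on the dual, has the same differential at \<open>\<eta>\<close> along
  the orbit as \<open>\<phi>\<close>. (The velocity at \<open>0\<close> of \<open>coad mul (t *\<^sub>R z) \<eta>\<close>, evaluated at \<open>x\<close>, is
  \<open>- \<eta> (br z x) = \<eta> (br x z)\<close>.) Two choices of \<open>x\<close> differ by an element of the stabilizer of \<open>\<eta>\<close>,
  so the value of \<open>poisson\<close> does not depend on them; it is the restriction of the linear Poisson
  bracket of the dual.
\<close>

definition is_diff :: "'n::finite grp \<Rightarrow> 'n bracket \<Rightarrow> ('n dual \<Rightarrow> real) \<Rightarrow> 'n dual \<Rightarrow> 'n vec \<Rightarrow> bool" where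
  "is_diff mul br \<phi> \<eta> x \<longleftrightarrow>
     (\<forall>z. ((\<lambda>t. \<phi> (coad mul (t *\<^sub>R z) \<eta>)) has_real_derivative \<eta> (br x z)) (at 0))"

definition poisson ::
  "'n::finite grp \<Rightarrow> 'n bracket \<Rightarrow> ('n dual \<Rightarrow> real) \<Rightarrow> ('n dual \<Rightarrow> real) \<Rightarrow> 'n dual \<Rightarrow> real" where
  "poisson mul br \<phi> \<psi> \<eta> =
     \<eta> (br (SOME x. is_diff mul br \<phi> \<eta> x) (SOME y. is_diff mul br \<psi> \<eta> y))"

definition lcoset :: "'n::finite grp \<Rightarrow> 'n vec set \<Rightarrow> 'n vec \<Rightarrow> 'n vec set" where
  "lcoset mul h x = (\<lambda>y. mul x y) ` h"

definition quot_smooth :: "'n::finite grp \<Rightarrow> 'n vec set \<Rightarrow> ('n vec set \<Rightarrow> real) \<Rightarrow> bool" where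
  "quot_smooth mul h \<psi> \<longleftrightarrow> smooth (\<lambda>x. \<psi> (lcoset mul h x))"

text \<open>Well defined on the orbit of \<open>f\<close> because a polarization contains the stabilizer of \<open>f\<close>.\<close>

definition orbit_proj :: "'n::finite grp \<Rightarrow> 'n dual \<Rightarrow> 'n vec set \<Rightarrow> 'n dual \<Rightarrow> 'n vec set" where
  "orbit_proj mul f h \<eta> = lcoset mul h (SOME x. coad mul x f = \<eta>)"

definition E0 :: "'n::finite grp \<Rightarrow> 'n dual \<Rightarrow> 'n vec set \<Rightarrow> ('n dual \<Rightarrow> real) set" where
  "E0 mul f h = {\<phi>. \<exists>\<psi>. quot_smooth mul h \<psi> \<and>
     (\<forall>\<eta>\<in>coad_orbit mul f. \<phi> \<eta> = \<psi> (orbit_proj mul f h \<eta>))}"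

definition E1 :: "'n::finite grp \<Rightarrow> 'n bracket \<Rightarrow> 'n dual \<Rightarrow> 'n vec set \<Rightarrow> ('n dual \<Rightarrow> real) set" where
  "E1 mul br f h = {\<phi>. orbit_smooth mul f \<phi> \<and>
     (\<forall>\<psi>\<in>E0 mul f h. poisson mul br \<phi> \<psi> \<in> E0 mul f h)}"

text \<open>\<open>exp(x_0 X_0) ... exp(x_{m-1} X_{m-1}) H\<close>\<close>

definition coexp_map ::
  "'n::finite grp \<Rightarrow> 'n vec set \<Rightarrow> nat \<Rightarrow> (nat \<Rightarrow> 'n vec) \<Rightarrow> (nat \<Rightarrow> real) \<Rightarrow> 'n vec set" where
  "coexp_map mul h m X x = lcoset mul h (foldl mul 0 (map (\<lambda>i. x i *\<^sub>R X i) [0..<m]))"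

definition coexp_coord ::
  "'n::finite grp \<Rightarrow> 'n vec set \<Rightarrow> nat \<Rightarrow> (nat \<Rightarrow> 'n vec) \<Rightarrow> 'n vec set \<Rightarrow> nat \<Rightarrow> real" where
  "coexp_coord mul h m X = inv_into (Rm m) (coexp_map mul h m X)"

definition coexponential_basis ::
  "'n::finite grp \<Rightarrow> 'n vec set \<Rightarrow> nat \<Rightarrow> (nat \<Rightarrow> 'n vec) \<Rightarrow> bool" where
  "coexponential_basis mul h m X \<longleftrightarrow>
     bij_betw (coexp_map mul h m X) (Rm m) (range (lcoset mul h)) \<and>
     (\<forall>\<psi>. quot_smooth mul h \<psi> \<longrightarrow> smooth_on m (Rm m) (\<lambda>x. \<psi> (coexp_map mul h m X x))) \<and>
     (\<forall>j<m. quot_smooth mul h (\<lambda>c. coexp_coord mul h m X c j))"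

definition q_coord ::
  "'n::finite grp \<Rightarrow> 'n dual \<Rightarrow> 'n vec set \<Rightarrow> nat \<Rightarrow> (nat \<Rightarrow> 'n vec) \<Rightarrow> 'n dual \<Rightarrow> nat \<Rightarrow> real" where
  "q_coord mul f h m X \<eta> = coexp_coord mul h m X (orbit_proj mul f h \<eta>)"

definition pq_map ::
  "nat \<Rightarrow> (nat \<Rightarrow> 'n::finite dual \<Rightarrow> real) \<Rightarrow> ('n dual \<Rightarrow> nat \<Rightarrow> real) \<Rightarrow>
   'n dual \<Rightarrow> (nat \<Rightarrow> real) \<times> (nat \<Rightarrow> real)" where
  "pq_map m p q \<eta> = ((\<lambda>i. if i < m then p i \<eta> else 0), q \<eta>)"

text \<open>
  For the smoothness of the inverse chart, \<open>W \<times> Rm m\<close> is written as a subset of \<open>Rm (2 * m)\<close>.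
\<close>

definition darboux_chart ::
  "'n::finite grp \<Rightarrow> 'n bracket \<Rightarrow> 'n dual \<Rightarrow> nat \<Rightarrow> (nat \<Rightarrow> 'n dual \<Rightarrow> real) \<Rightarrow>
   ('n dual \<Rightarrow> nat \<Rightarrow> real) \<Rightarrow> (nat \<Rightarrow> real) set \<Rightarrow> bool" where
  "darboux_chart mul br f m p q W \<longleftrightarrow>
     openin (Euclidean_space m) W \<and>
     bij_betw (pq_map m p q) (coad_orbit mul f) (W \<times> Rm m) \<and>
     (\<forall>i<m. orbit_smooth mul f (p i) \<and> orbit_smooth mul f (\<lambda>\<eta>. q \<eta> i)) \<and>
     (\<forall>y. smooth_on (2 * m) {x \<in> Rm (2 * m). (\<lambda>i. if i < m then x i else 0) \<in> W}
        (\<lambda>x. inv_into (coad_orbit mul f) (pq_map m p q)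
               ((\<lambda>i. if i < m then x i else 0), (\<lambda>i. if i < m then x (m + i) else 0)) y)) \<and>
     (\<forall>\<eta>\<in>coad_orbit mul f. \<forall>i<m. \<forall>j<m.
        poisson mul br (p i) (p j) \<eta> = 0 \<and>
        poisson mul br (\<lambda>\<zeta>. q \<zeta> i) (\<lambda>\<zeta>. q \<zeta> j) \<eta> = 0 \<and>
        poisson mul br (p i) (\<lambda>\<zeta>. q \<zeta> j) \<eta> = (if i = j then 1 else 0))"

text \<open>\<open>a x u\<close> and \<open>a0 x\<close> are the entire functions \<open>a_{x,u}\<close> and \<open>a_{x,0}\<close>.\<close>

definition pedersen_coords ::
  "'n::finite grp \<Rightarrow> 'n bracket \<Rightarrow> 'n dual \<Rightarrow> 'n vec set \<Rightarrow> nat \<Rightarrow> (nat \<Rightarrow> 'n vec) \<Rightarrow>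
   (nat \<Rightarrow> 'n dual \<Rightarrow> real) \<Rightarrow> (nat \<Rightarrow> real) set \<Rightarrow>
   ('n vec \<Rightarrow> nat \<Rightarrow> (nat \<Rightarrow> complex) \<Rightarrow> complex) \<Rightarrow>
   ('n vec \<Rightarrow> (nat \<Rightarrow> complex) \<Rightarrow> complex) \<Rightarrow> bool" where
  "pedersen_coords mul br f h m X p W a a0 \<longleftrightarrow>
     coexponential_basis mul h m X \<and>
     (\<forall>i<m. p i \<in> E1 mul br f h) \<and>
     darboux_chart mul br f m p (q_coord mul f h m X) W \<and>
     (\<forall>x. entire m (a0 x) \<and> (\<forall>u<m. entire m (a x u))) \<and>
     (\<forall>\<eta>\<in>coad_orbit mul f. \<forall>x.
        complex_of_real (blinfun_apply \<eta> x) =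
          (\<Sum>u<m. a x u (\<lambda>j. complex_of_real (q_coord mul f h m X \<eta> j)) * complex_of_real (p u \<eta>))
          + a0 x (\<lambda>j. complex_of_real (q_coord mul f h m X \<eta> j)))"


section \<open>The symmetric and tensor algebras\<close>

text \<open>
  Over the complex numbers and with respect to the standard basis \<open>axis i 1\<close>: the symmetric algebra
  is the algebra of polynomials in the basis vectors, the tensor algebra is the algebra of the free
  monoid of words in them.
\<close>

datatype 'n tword = TWord (letters: "'n list")

instantiation tword :: (type) monoid_add
begin

definition zero_tword :: "'a tword" where
  "zero_tword = TWord []"

definition plus_tword :: "'a tword \<Rightarrow> 'a tword \<Rightarrow> 'a tword" where
  "plus_tword v w = TWord (letters v @ letters w)"

instance
  by standard (simp_all add: zero_tword_def plus_tword_def)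

end

type_synonym 'n sym_alg = "('n \<Rightarrow>\<^sub>0 nat) \<Rightarrow>\<^sub>0 complex"
type_synonym 'n tens_alg = "'n tword \<Rightarrow>\<^sub>0 complex"

definition sym_eval :: "'n::finite sym_alg \<Rightarrow> complex ^ 'n \<Rightarrow> complex" where
  "sym_eval P z = (\<Sum>\<beta>\<in>Poly_Mapping.keys P.
     Poly_Mapping.lookup P \<beta> * (\<Prod>i\<in>UNIV. (z $ i) ^ Poly_Mapping.lookup \<beta> i))"

text \<open>
  Symmetrization. The average over all permutations of the factors of a monomial equals the average
  over its distinct rearrangements, each of which arises from equally many permutations.
\<close>

definition arrangements :: "('n \<Rightarrow>\<^sub>0 nat) \<Rightarrow> 'n tword set" where
  "arrangements \<beta> = {w. \<forall>i. count_list (letters w) i = Poly_Mapping.lookup \<beta> i}"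

definition symmetrize :: "'n::finite sym_alg \<Rightarrow> 'n tens_alg" where
  "symmetrize P = (\<Sum>\<beta>\<in>Poly_Mapping.keys P. \<Sum>w\<in>arrangements \<beta>.
     Poly_Mapping.single w (Poly_Mapping.lookup P \<beta> / of_nat (card (arrangements \<beta>))))"


section \<open>The Duflo isomorphism\<close>

text \<open>
  The constant-coefficient operator \<open>s(D)\<close> with polynomial symbol \<open>s\<close>, where the \<open>i\<close>-th coordinate of
  the Lie algebra stands for the derivation dual to the \<open>i\<close>-th basis vector. The product vanishes
  unless \<open>\<alpha> \<le> \<beta>\<close>.
\<close>

definition diff_op :: "'n::finite sym_alg \<Rightarrow> 'n sym_alg \<Rightarrow> 'n sym_alg" where
  "diff_op s P = (\<Sum>\<alpha>\<in>Poly_Mapping.keys s. \<Sum>\<beta>\<in>Poly_Mapping.keys P.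
     Poly_Mapping.single (\<beta> - \<alpha>)
       (Poly_Mapping.lookup s \<alpha> * Poly_Mapping.lookup P \<beta> *
        (\<Prod>i\<in>UNIV. \<Prod>j<Poly_Mapping.lookup \<alpha> i. of_nat (Poly_Mapping.lookup \<beta> i) - of_nat j)))"

text \<open>The matrix of \<open>ad x\<close>, with entries linear forms in the coordinates of the generic point \<open>x\<close>.\<close>

definition ad_matrix :: "'n::finite bracket \<Rightarrow> 'n sym_alg ^ 'n ^ 'n" where
  "ad_matrix br = (\<chi> k j. \<Sum>i\<in>UNIV.
     Poly_Mapping.single (Poly_Mapping.single i 1)
       (complex_of_real (br (axis i 1) (axis j 1) $ k)))"

fun mat_power :: "'a::semiring_1 ^ 'n::finite ^ 'n \<Rightarrow> nat \<Rightarrow> 'a ^ 'n ^ 'n" where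
  "mat_power A 0 = mat 1"
| "mat_power A (Suc k) = A ** mat_power A k"

text \<open>\<open>det (sinh (ad (\<nu>/2) x) / (ad (\<nu>/2) x))\<close>, with \<open>sinh z / z = \<Sum>k. z^(2k) / (2k+1)!\<close>.\<close>

definition duflo_J :: "'n::finite bracket \<Rightarrow> 'n sym_alg fps" where
  "duflo_J br = det (\<chi> k j. Abs_fps (\<lambda>n. if even n
     then Poly_Mapping.single 0 (1 / (2 ^ n * fact (n + 1))) * mat_power (ad_matrix br) n $ k $ j
     else 0))"

text \<open>
  The square root with constant term \<open>1\<close>, by the binomial series in \<open>J - 1\<close>, which has no constant
  term.
\<close>

definition duflo_sqrtJ :: "'n::finite bracket \<Rightarrow> 'n sym_alg fps" where
  "duflo_sqrtJ br = Abs_fps (\<lambda>n. \<Sum>r\<le>n.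
     Poly_Mapping.single 0 ((1 / 2 :: complex) gchoose r) * fps_nth ((duflo_J br - 1) ^ r) n)"

definition apply_sqrtJ :: "'n::finite bracket \<Rightarrow> 'n sym_alg fps \<Rightarrow> 'n sym_alg fps" where
  "apply_sqrtJ br u =
     Abs_fps (\<lambda>n. \<Sum>k\<le>n. diff_op (fps_nth (duflo_sqrtJ br) k) (fps_nth u (n - k)))"

definition tens_vec :: "complex ^ 'n::finite \<Rightarrow> 'n tens_alg" where
  "tens_vec x = (\<Sum>i\<in>UNIV. Poly_Mapping.single (TWord [i]) (x $ i))"

definition cbracket :: "'n::finite bracket \<Rightarrow> complex ^ 'n \<Rightarrow> complex ^ 'n \<Rightarrow> complex ^ 'n" where
  "cbracket br x y = (\<chi> k. \<Sum>i\<in>UNIV. \<Sum>j\<in>UNIV.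
     x $ i * y $ j * complex_of_real (br (axis i 1) (axis j 1) $ k))"

inductive_set deform_ideal :: "'n::finite bracket \<Rightarrow> 'n tens_alg fps set"
  for br :: "'n::finite bracket" where
  zero: "0 \<in> deform_ideal br"
| step: "S \<in> deform_ideal br \<Longrightarrow>
     S + A * (fps_const (tens_vec x * tens_vec y - tens_vec y * tens_vec x)
              - fps_X * fps_const (tens_vec (cbracket br x y))) * B \<in> deform_ideal br"

text \<open>
  The quotient is taken by the \<open>\<nu>\<close>-adically closed ideal (the closure is in the library's metric on
  formal power series, whose topology is the \<open>\<nu>\<close>-adic one); otherwise it need not be \<open>\<nu>\<close>-adically
  separated. Elements of the deformed enveloping algebra are cosets.
\<close>

definition U_rel :: "'n::finite bracket \<Rightarrow> ('n tens_alg fps \<times> 'n tens_alg fps) set" where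
  "U_rel br = {(S, T). S - T \<in> closure (deform_ideal br)}"

definition U_alg :: "'n::finite bracket \<Rightarrow> 'n tens_alg fps set set" where
  "U_alg br = UNIV // U_rel br"

definition U_mult :: "'n::finite bracket \<Rightarrow> 'n tens_alg fps set \<Rightarrow> 'n tens_alg fps set \<Rightarrow> 'n tens_alg fps set" where
  "U_mult br c d = U_rel br `` {(SOME S. S \<in> c) * (SOME T. T \<in> d)}"

definition duflo :: "'n::finite bracket \<Rightarrow> 'n sym_alg fps \<Rightarrow> 'n tens_alg fps set" where
  "duflo br u = U_rel br `` {Abs_fps (\<lambda>n. symmetrize (fps_nth (apply_sqrtJ br u) n))}"

text \<open>
  The product of the deformed algebra. A module over this algebra is a module over \<open>U_alg br\<close>
  by way of \<open>duflo br\<close>, and it is in this form that the representation is given below.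
\<close>

definition star :: "'n::finite bracket \<Rightarrow> 'n sym_alg fps \<Rightarrow> 'n sym_alg fps \<Rightarrow> 'n sym_alg fps" where
  "star br u v = the_inv_into UNIV (duflo br) (U_mult br (duflo br u) (duflo br v))"


section \<open>The representation\<close>

text \<open>
  A formal power series with coefficients \<open>\<xi>_n\<close> in \<open>CK m K\<close> is represented as the function
  \<open>t \<mapsto> \<Sum>n. \<xi>_n t \<nu>^n\<close> with values in formal power series.
\<close>

definition nu_module :: "nat \<Rightarrow> (nat \<Rightarrow> real) set \<Rightarrow> ((nat \<Rightarrow> real) \<Rightarrow> complex fps) set" where
  "nu_module m K = {\<xi>. \<forall>n. (\<lambda>t. fps_nth (\<xi> t) n) \<in> CK m K}"

definition fps_pdiff ::
  "nat \<Rightarrow> ((nat \<Rightarrow> real) \<Rightarrow> complex fps) \<Rightarrow> (nat \<Rightarrow> real) \<Rightarrow> complex fps" where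
  "fps_pdiff u \<xi> t = Abs_fps (\<lambda>n. pdiff u (\<lambda>s. fps_nth (\<xi> s) n) t)"

text \<open>The expansion of \<open>F (- i \<nu> t)\<close> in powers of \<open>\<nu>\<close>.\<close>

definition expand_at :: "((nat \<Rightarrow> complex) \<Rightarrow> complex) \<Rightarrow> (nat \<Rightarrow> real) \<Rightarrow> complex fps" where
  "expand_at F t = Abs_fps (\<lambda>n.
     (deriv ^^ n) (\<lambda>\<nu>. F (\<lambda>j. - \<i> * \<nu> * complex_of_real (t j))) 0 / fact n)"

definition pi_op ::
  "nat \<Rightarrow> ('n::finite vec \<Rightarrow> nat \<Rightarrow> (nat \<Rightarrow> complex) \<Rightarrow> complex) \<Rightarrow>
   ('n vec \<Rightarrow> (nat \<Rightarrow> complex) \<Rightarrow> complex) \<Rightarrow>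
   'n vec \<Rightarrow> ((nat \<Rightarrow> real) \<Rightarrow> complex fps) \<Rightarrow> (nat \<Rightarrow> real) \<Rightarrow> complex fps" where
  "pi_op m a a0 x \<xi> t =
     (\<Sum>u<m. fps_const \<i> * expand_at (a x u) t * fps_pdiff u \<xi> t)
     + expand_at (a0 x) t * \<xi> t
     + fps_const (1 / 2) * fps_X * (\<Sum>u<m. expand_at (cpdiff u (a x u)) t) * \<xi> t"

definition tens_act ::
  "nat \<Rightarrow> ('n::finite vec \<Rightarrow> nat \<Rightarrow> (nat \<Rightarrow> complex) \<Rightarrow> complex) \<Rightarrow>
   ('n vec \<Rightarrow> (nat \<Rightarrow> complex) \<Rightarrow> complex) \<Rightarrow>
   'n tens_alg \<Rightarrow> ((nat \<Rightarrow> real) \<Rightarrow> complex fps) \<Rightarrow> (nat \<Rightarrow> real) \<Rightarrow> complex fps" where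
  "tens_act m a a0 T \<xi> t = (\<Sum>w\<in>Poly_Mapping.keys T. fps_const (Poly_Mapping.lookup T w) *
     foldr (\<lambda>i. pi_op m a a0 (axis i 1)) (letters w) \<xi> t)"

definition tens_fps_act ::
  "nat \<Rightarrow> ('n::finite vec \<Rightarrow> nat \<Rightarrow> (nat \<Rightarrow> complex) \<Rightarrow> complex) \<Rightarrow>
   ('n vec \<Rightarrow> (nat \<Rightarrow> complex) \<Rightarrow> complex) \<Rightarrow>
   'n tens_alg fps \<Rightarrow> ((nat \<Rightarrow> real) \<Rightarrow> complex fps) \<Rightarrow> (nat \<Rightarrow> real) \<Rightarrow> complex fps" where
  "tens_fps_act m a a0 S \<xi> t =
     Abs_fps (\<lambda>n. \<Sum>k\<le>n. fps_nth (tens_act m a a0 (fps_nth S k) \<xi> t) (n - k))"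

text \<open>
  The action of the deformed algebra. The choice of a representative is immaterial by
  \<open>[\<pi>(x), \<pi>(y)] = \<nu> \<pi>([x, y])\<close>.
\<close>

definition alg_act ::
  "'n::finite bracket \<Rightarrow> nat \<Rightarrow> ('n vec \<Rightarrow> nat \<Rightarrow> (nat \<Rightarrow> complex) \<Rightarrow> complex) \<Rightarrow>
   ('n vec \<Rightarrow> (nat \<Rightarrow> complex) \<Rightarrow> complex) \<Rightarrow>
   'n sym_alg fps \<Rightarrow> ((nat \<Rightarrow> real) \<Rightarrow> complex fps) \<Rightarrow> (nat \<Rightarrow> real) \<Rightarrow> complex fps" where
  "alg_act br m a a0 u \<xi> = tens_fps_act m a a0 (SOME S. S \<in> duflo br u) \<xi>"


section \<open>The characteristic variety\<close>

text \<open>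
  Reduction modulo \<open>\<nu>\<close> is \<open>u \<mapsto> fps_nth u 0\<close>, both on the deformed algebra and on the module: an
  element of the module lies in \<open>\<nu>\<close> times the module iff its coefficient of order \<open>0\<close> vanishes.
\<close>

definition classical_annihilator ::
  "'n::finite bracket \<Rightarrow> nat \<Rightarrow> ('n vec \<Rightarrow> nat \<Rightarrow> (nat \<Rightarrow> complex) \<Rightarrow> complex) \<Rightarrow>
   ('n vec \<Rightarrow> (nat \<Rightarrow> complex) \<Rightarrow> complex) \<Rightarrow> (nat \<Rightarrow> real) set \<Rightarrow> 'n sym_alg set" where
  "classical_annihilator br m a a0 K = {P. \<forall>u. fps_nth u 0 = P \<longrightarrow>
     (\<forall>\<xi>\<in>nu_module m K. \<forall>t. fps_nth (alg_act br m a a0 u \<xi> t) 0 = 0)}"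

definition char_variety ::
  "'n::finite bracket \<Rightarrow> nat \<Rightarrow> ('n vec \<Rightarrow> nat \<Rightarrow> (nat \<Rightarrow> complex) \<Rightarrow> complex) \<Rightarrow>
   ('n vec \<Rightarrow> (nat \<Rightarrow> complex) \<Rightarrow> complex) \<Rightarrow> (nat \<Rightarrow> real) set \<Rightarrow> (complex ^ 'n) set" where
  "char_variety br m a a0 K =
     {z. \<forall>P\<in>classical_annihilator br m a a0 K. sym_eval P z = 0}"

definition real_points :: "(complex ^ 'n::finite) set \<Rightarrow> 'n dual set" where
  "real_points V = {\<eta> :: 'n dual. (\<chi> i. complex_of_real (\<eta> (axis i 1))) \<in> V}"

end

theory Submission
  imports Defs
begin

text \<open>
  Modulo \<open>\<nu>\<close> the coefficients \<open>a_{X,u}(- i \<nu> t)\<close> become the constants \<open>a_{X,u}(0)\<close>, so a basis vector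
  \<open>e_i\<close> acts on \<open>CK m K\<close> by the first-order operator \<open>\<Sum>u. i A_{iu} \<partial>_u + B_i\<close> with constant
  coefficients. These operators commute, so the defining ideal of the deformed enveloping algebra acts
  by zero modulo \<open>\<nu>\<close>, and a polynomial \<open>P\<close> acts by substitution. On a test function that equals
  \<open>exp (\<zeta> \<bullet> t)\<close> near a point of \<open>K\<close>, \<open>P\<close> acts there by the scalar \<open>P (i A \<zeta> + B)\<close>. Hence the
  annihilator consists of the polynomials vanishing on the affine space \<open>{B + A v}\<close>.

  The points \<open>B + A p\<close> with \<open>p \<in> W\<close> are those of the orbit with \<open>q = 0\<close>. They lie over the coset \<open>H\<close>,
  so they belong to \<open>H.f\<close>, and \<open>H.f \<subseteq> f + h\<^sup>\<bottom>\<close>. As \<open>W\<close> is open and \<open>p \<mapsto> B + A p\<close> is injective, the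
  affine spaces \<open>{B + A p}\<close> and \<open>f + h\<^sup>\<bottom>\<close> have the same dimension \<open>m\<close> and coincide.
\<close>

section \<open>Mixed partial derivatives\<close>

text \<open>The mean value theorem is applied first in \<open>r\<close> to
  \<open>G r (b + e) - G r b\<close>, then in \<open>s\<close> to \<open>G1 x\<close>. The second
  difference on the left is symmetric in the two variables, so the lemma serves both orders of
  differentiation.\<close>

lemma mixed_difference_mean_value:
  fixes G G1 G12 :: "real \<Rightarrow> real \<Rightarrow> real"
  assumes d1: "\<And>r s. ((\<lambda>r. G r s) has_real_derivative G1 r s) (at r)"
    and d12: "\<And>r s. ((\<lambda>s. G1 r s) has_real_derivative G12 r s) (at s)"
    and "e > 0"
  shows "\<exists>x y. a < x \<and> x < a + e \<and> b < y \<and> y < b + e \<and>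
    G (a + e) (b + e) - G (a + e) b - G a (b + e) + G a b = e * e * G12 x y"
proof -
  have "\<And>r. ((\<lambda>r. G r (b + e) - G r b) has_real_derivative (G1 r (b + e) - G1 r b)) (at r)"
    by (intro derivative_intros d1)
  from MVT2[of a "a + e", OF _ this] \<open>e > 0\<close> obtain x where x: "a < x" "x < a + e"
    "(G (a + e) (b + e) - G (a + e) b) - (G a (b + e) - G a b) = e * (G1 x (b + e) - G1 x b)"
    by auto
  from MVT2[of b "b + e", OF _ d12] \<open>e > 0\<close> obtain y where y: "b < y" "y < b + e"
    "G1 x (b + e) - G1 x b = e * G12 x y"
    by auto
  from x y show ?thesis by (intro exI[of _ x] exI[of _ y]) (auto simp: algebra_simps)
qed

text \<open>Schwarz's theorem. On a small square one and the same second difference yields a value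
  of \<open>G12\<close> equal to a value of \<open>G21\<close>, while continuity would keep the two
  functions apart there if they differed at \<open>(a, b)\<close>.\<close>

lemma symmetric_mixed_derivatives:
  fixes G G1 G2 G12 G21 :: "real \<Rightarrow> real \<Rightarrow> real"
  assumes d1: "\<And>r s. ((\<lambda>r. G r s) has_real_derivative G1 r s) (at r)"
    and d2: "\<And>r s. ((\<lambda>s. G r s) has_real_derivative G2 r s) (at s)"
    and d12: "\<And>r s. ((\<lambda>s. G1 r s) has_real_derivative G12 r s) (at s)"
    and d21: "\<And>r s. ((\<lambda>r. G2 r s) has_real_derivative G21 r s) (at r)"
    and c12: "continuous_on UNIV (\<lambda>z. G12 (fst z) (snd z))"
    and c21: "continuous_on UNIV (\<lambda>z. G21 (fst z) (snd z))"
  shows "G12 a b = G21 a b"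
proof (rule ccontr)
  assume ne: "G12 a b \<noteq> G21 a b"
  \<comment> \<open>Half the gap, so that values within \<open>e\<close> of \<open>G12 a b\<close>
    and of \<open>G21 a b\<close> cannot coincide.\<close>
  define e where "e = \<bar>G12 a b - G21 a b\<bar> / 2"
  have e: "e > 0" using ne by (simp add: e_def)
  from c12 e obtain r1 where r1: "r1 > 0"
    "\<And>z. dist z (a, b) < r1 \<Longrightarrow> dist (G12 (fst z) (snd z)) (G12 a b) < e"
    unfolding continuous_on_iff by (metis UNIV_I fst_conv snd_conv)
  from c21 e obtain r2 where r2: "r2 > 0"
    "\<And>z. dist z (a, b) < r2 \<Longrightarrow> dist (G21 (fst z) (snd z)) (G21 a b) < e"
    unfolding continuous_on_iff by (metis UNIV_I fst_conv snd_conv)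
  \<comment> \<open>The halving pays for bounding the Euclidean distance by the sum of two
    coordinate differences.\<close>
  define t where "t = min r1 r2 / 2"
  have t: "t > 0" using r1 r2 by (simp add: t_def)
  have near: "dist (x, y) (a, b) < min r1 r2" if "a < x" "x < a + t" "b < y" "y < b + t" for x y
  proof -
    have "dist (x, y) (a, b) = sqrt ((x - a)\<^sup>2 + (y - b)\<^sup>2)"
      by (simp add: dist_Pair_Pair dist_real_def)
    also have "\<dots> \<le> \<bar>x - a\<bar> + \<bar>y - b\<bar>" by (rule sqrt_sum_squares_le_sum_abs)
    also have "\<dots> < t + t" using that by linarith
    finally show ?thesis by (simp add: t_def)
  qed
  obtain x y where xy: "a < x" "x < a + t" "b < y" "y < b + t"
    "G (a + t) (b + t) - G (a + t) b - G a (b + t) + G a b = t * t * G12 x y"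
    using mixed_difference_mean_value[OF d1 d12 t] by blast
  \<comment> \<open>The same lemma with the two variables exchanged.\<close>
  obtain y' x' where xy': "b < y'" "y' < b + t" "a < x'" "x' < a + t"
    "G (a + t) (b + t) - G a (b + t) - G (a + t) b + G a b = t * t * G21 x' y'"
    using mixed_difference_mean_value[of "\<lambda>s r. G r s" "\<lambda>s r. G2 r s" "\<lambda>s r. G21 r s", OF d2 d21 t]
    by blast
  have "t * t * G12 x y = t * t * G21 x' y'" using xy xy' by linarith
  with t have "G12 x y = G21 x' y'" by simp
  moreover have "dist (G12 x y) (G12 a b) < e" using r1(2)[of "(x, y)"] near xy by simp
  moreover have "dist (G21 x' y') (G21 a b) < e" using r2(2)[of "(x', y')"] near xy' by simp
  ultimately have "G12 a b - G21 a b < 2 * e" "G21 a b - G12 a b < 2 * e"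
    unfolding dist_real_def abs_less_iff by linarith+
  then show False by (auto simp: e_def abs_if split: if_splits)
qed

text \<open>Functions vanishing off \<open>Rm m\<close>: then identities between them need no restriction on the argument.\<close>

definition smooth_fns :: "nat \<Rightarrow> ((nat \<Rightarrow> real) \<Rightarrow> complex) set" where
  "smooth_fns m = {F. smooth_on m (Rm m) F \<and> (\<forall>t. t \<notin> Rm m \<longrightarrow> F t = 0)}"

section \<open>Partial derivatives on the coordinate space\<close>

lemma Rm_upd: "i < m \<Longrightarrow> t(i := s) \<in> Rm m \<longleftrightarrow> t \<in> Rm m"
  by (auto simp: topspace_Euclidean_space)

lemma has_pdiff:
  assumes "(\<lambda>s. F (t(i := s))) differentiable (at (t i))"
  shows "((\<lambda>s. F (t(i := s))) has_vector_derivative pdiff i F t) (at (t i))"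
  using assms unfolding pdiff_def by (simp add: vector_derivative_works)

lemma ck_on_diff:
  "\<lbrakk>ck_on m (Suc k) U F; i < m; t \<in> U\<rbrakk> \<Longrightarrow>
    ((\<lambda>s. F (t(i := s))) has_vector_derivative pdiff i F t) (at (t i))"
  by (rule has_pdiff) simp

lemma pdiff_off:
  assumes "\<And>t. t \<notin> Rm m \<Longrightarrow> F t = 0" "t \<notin> Rm m" "i < m"
  shows "pdiff i F t = 0"
proof -
  have "(\<lambda>s. F (t(i := s))) = (\<lambda>s. 0)" using assms by (auto simp: Rm_upd)
  then show ?thesis unfolding pdiff_def by simp
qed

text \<open>The combination \<open>c * F + G\<close> covers sums and multiples at once. Off
  \<open>Rm m\<close> both sides vanish, which makes this an equality of functions, usable under
  further derivatives.\<close>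

lemma pdiff_lin:
  assumes F: "ck_on m (Suc k) (Rm m) F" "\<And>t. t \<notin> Rm m \<Longrightarrow> F t = 0"
    and G: "ck_on m (Suc l) (Rm m) G" "\<And>t. t \<notin> Rm m \<Longrightarrow> G t = 0"
    and i: "i < m"
  shows "pdiff i (\<lambda>t. c * F t + G t) = (\<lambda>t. c * pdiff i F t + (pdiff i G t :: complex))"
proof
  fix t
  show "pdiff i (\<lambda>t. c * F t + G t) t = c * pdiff i F t + pdiff i G t"
  proof (cases "t \<in> Rm m")
    case True
    have "((\<lambda>s. c * F (t(i := s)) + G (t(i := s))) has_vector_derivative
        c * pdiff i F t + pdiff i G t) (at (t i))"
      by (intro derivative_intros ck_on_diff[OF F(1) i True] ck_on_diff[OF G(1) i True])
    then show ?thesis unfolding pdiff_def by (rule vector_derivative_at)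
  next
    case False
    then have "pdiff i (\<lambda>t. c * F t + G t) t = 0"
      by (intro pdiff_off[of m]) (use F G i in auto)
    with False show ?thesis using pdiff_off[of m F t] pdiff_off[of m G t] F G i by simp
  qed
qed

lemma ck_on_lin:
  fixes F G :: "(nat \<Rightarrow> real) \<Rightarrow> complex"
  assumes "ck_on m k (Rm m) F" "\<And>t. t \<notin> Rm m \<Longrightarrow> F t = 0"
    and "ck_on m k (Rm m) G" "\<And>t. t \<notin> Rm m \<Longrightarrow> G t = 0"
  shows "ck_on m k (Rm m) (\<lambda>t. c * F t + G t)"
  using assms
proof (induction k arbitrary: F G)
  case 0
  then show ?case by (auto intro!: continuous_intros)
next
  case (Suc k)
  have "(\<lambda>s. c * F (t(i := s)) + G (t(i := s))) differentiable (at (t i))"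
    if "i < m" "t \<in> Rm m" for i t
    using Suc.prems that by (auto intro!: derivative_intros)
  moreover have "ck_on m k (Rm m) (pdiff i (\<lambda>t. c * F t + G t))" if "i < m" for i
  proof -
    have eq: "pdiff i (\<lambda>t. c * F t + G t) = (\<lambda>t. c * pdiff i F t + pdiff i G t)"
      by (rule pdiff_lin[of m k F k G]) (use Suc.prems that in auto)
    show ?thesis
      unfolding eq
    proof (rule Suc.IH)
      show "ck_on m k (Rm m) (pdiff i F)" "ck_on m k (Rm m) (pdiff i G)"
        using Suc.prems that by auto
      show "\<And>t. t \<notin> Rm m \<Longrightarrow> pdiff i F t = 0" "\<And>t. t \<notin> Rm m \<Longrightarrow> pdiff i G t = 0"
        using pdiff_off[of m] Suc.prems(2,4) that by blast+
    qed
  qed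
  ultimately show ?case using Suc.prems by (auto intro!: continuous_intros)
qed

lemma smooth_fns_ck: "F \<in> smooth_fns m \<Longrightarrow> ck_on m k (Rm m) F"
  by (simp add: smooth_fns_def smooth_on_def)

lemma smooth_fns_off: "F \<in> smooth_fns m \<Longrightarrow> t \<notin> Rm m \<Longrightarrow> F t = 0"
  by (simp add: smooth_fns_def)

lemma smooth_fns_lin:
  "F \<in> smooth_fns m \<Longrightarrow> G \<in> smooth_fns m \<Longrightarrow> (\<lambda>t. c * F t + G t) \<in> smooth_fns m"
  by (auto simp: smooth_fns_def smooth_on_def intro!: ck_on_lin)

lemma pdiff_smooth_fns:
  assumes "F \<in> smooth_fns m" "i < m"
  shows "pdiff i F \<in> smooth_fns m"
proof -
  have "ck_on m k (Rm m) (pdiff i F)" for k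
    using smooth_fns_ck[OF assms(1), of "Suc k"] assms(2) by simp
  then show ?thesis
    using pdiff_off[of m F] assms by (auto simp: smooth_fns_def smooth_on_def)
qed

lemma zero_smooth_fns: "(\<lambda>t. 0) \<in> smooth_fns m"
proof -
  have "ck_on m k U (\<lambda>t. 0 :: complex)" for k U
    by (induction k) (simp_all add: pdiff_def[abs_def])
  then show ?thesis by (simp add: smooth_fns_def smooth_on_def)
qed

lemma pdiff_lin_smooth_fns:
  assumes "F \<in> smooth_fns m" "G \<in> smooth_fns m" "i < m"
  shows "pdiff i (\<lambda>t. c * F t + G t) = (\<lambda>t. c * pdiff i F t + pdiff i G t)"
  using assms by (intro pdiff_lin[of m 0 _ 0] smooth_fns_ck) (auto simp: smooth_fns_off)

text \<open>Freezing all coordinates but \<open>i\<close> and \<open>j\<close> reduces the claim to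
  two variables. Schwarz's theorem is then applied to the real and to the imaginary part.\<close>

lemma pdiff_commute:
  assumes F: "F \<in> smooth_fns m" and i: "i < m" and j: "j < m"
  shows "pdiff i (pdiff j F) = pdiff j (pdiff i F)"
proof
  fix t
  consider "i = j" | "t \<notin> Rm m" | "i \<noteq> j" "t \<in> Rm m" by auto
  then show "pdiff i (pdiff j F) t = pdiff j (pdiff i F) t"
  proof cases
    case 1
    then show ?thesis by simp
  next
    case 2
    then show ?thesis using F i j by (metis smooth_fns_off pdiff_smooth_fns)
  next
    case 3
    define T where "T r s = t(i := r, j := s)" for r s
    have T: "T r s \<in> Rm m" for r s using 3 i j by (simp add: T_def Rm_upd)
    have Tr: "(T r s)(i := x) = T x s" "(T r s)(j := x) = T r x" "T r s i = r" "T r s j = s" for r s x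
      using 3 by (auto simp: T_def)
    have di: "((\<lambda>r. H (T r s)) has_vector_derivative pdiff i H (T r s)) (at r)"
      if "H \<in> smooth_fns m" for H r s
      using ck_on_diff[OF smooth_fns_ck[OF that, of "Suc 0"] i T[of r s]] by (simp add: Tr)
    have dj: "((\<lambda>s. H (T r s)) has_vector_derivative pdiff j H (T r s)) (at s)"
      if "H \<in> smooth_fns m" for H r s
      using ck_on_diff[OF smooth_fns_ck[OF that, of "Suc 0"] j T[of r s]] by (simp add: Tr)
    have cT: "continuous_on UNIV (\<lambda>z. T (fst z) (snd z))"
    proof (rule continuous_on_coordinatewise_then_product)
      show "continuous_on UNIV (\<lambda>z. T (fst z) (snd z) k)" for k
        by (cases "k = i"; cases "k = j") (auto simp: T_def intro!: continuous_intros)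
    qed
    have c: "continuous_on UNIV (\<lambda>z. H (T (fst z) (snd z)))" if "H \<in> smooth_fns m" for H
      using smooth_fns_ck[OF that, of 0] cT T
      by (auto intro!: continuous_on_compose2[of "Rm m" H])
    note sm = F pdiff_smooth_fns[OF F i] pdiff_smooth_fns[OF F j]
      pdiff_smooth_fns[OF pdiff_smooth_fns[OF F i] j] pdiff_smooth_fns[OF pdiff_smooth_fns[OF F j] i]
    have lin: "((\<lambda>r. l (h r)) has_real_derivative l h') (at r)"
      if "bounded_linear l" "(h has_vector_derivative h') (at r)" for l :: "complex \<Rightarrow> real" and h h' r
      using bounded_linear.has_vector_derivative[OF that]
      by (simp add: has_real_derivative_iff_has_vector_derivative)
    have eq: "l (pdiff j (pdiff i F) (T (t i) (t j))) = l (pdiff i (pdiff j F) (T (t i) (t j)))"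
      if l: "bounded_linear l" for l :: "complex \<Rightarrow> real"
    proof (rule symmetric_mixed_derivatives[where G = "\<lambda>r s. l (F (T r s))"
        and ?G1.0 = "\<lambda>r s. l (pdiff i F (T r s))" and ?G2.0 = "\<lambda>r s. l (pdiff j F (T r s))"
        and ?G12.0 = "\<lambda>r s. l (pdiff j (pdiff i F) (T r s))"
        and ?G21.0 = "\<lambda>r s. l (pdiff i (pdiff j F) (T r s))"])
    qed (auto intro!: lin[OF l] di dj sm bounded_linear.continuous_on[OF l] c)
    have "T (t i) (t j) = t" by (auto simp: T_def)
    then show ?thesis
      using eq[OF bounded_linear_Re] eq[OF bounded_linear_Im] by (simp add: complex_eq_iff)
  qed
qed

section \<open>Test functions\<close>

text \<open>Differentiability of order \<open>k\<close> in one variable. Level 0 asks for no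
  continuity; where continuity is wanted it comes from level 1.\<close>

fun ndiff :: "nat \<Rightarrow> (real \<Rightarrow> complex) \<Rightarrow> bool" where
  "ndiff 0 g \<longleftrightarrow> True"
| "ndiff (Suc k) g \<longleftrightarrow>
    (\<forall>x. g differentiable (at x)) \<and> ndiff k (\<lambda>x. vector_derivative g (at x))"

lemma ndiff_SucI:
  assumes "\<And>x. (g has_vector_derivative g' x) (at x)" "ndiff k g'"
  shows "ndiff (Suc k) g"
proof -
  have "(\<lambda>x. vector_derivative g (at x)) = g'"
    using assms(1) by (auto intro: vector_derivative_at)
  then show ?thesis using assms by (auto intro: differentiableI_vector)
qed

lemma ndiff_SucD:
  "ndiff (Suc k) g \<Longrightarrow> (g has_vector_derivative vector_derivative g (at x)) (at x)"
  by (simp add: vector_derivative_works[symmetric])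

lemma ndiff_mono: "ndiff (Suc k) g \<Longrightarrow> ndiff k g"
  by (induction k arbitrary: g) auto

lemma ndiff_const: "ndiff k (\<lambda>x. c)"
proof (induction k arbitrary: c)
  case (Suc k)
  show ?case by (rule ndiff_SucI[OF has_vector_derivative_const Suc.IH])
qed simp

lemma ndiff_add: "ndiff k f \<Longrightarrow> ndiff k g \<Longrightarrow> ndiff k (\<lambda>x. f x + g x)"
proof (induction k arbitrary: f g)
  case (Suc k)
  show ?case
    by (rule ndiff_SucI[OF has_vector_derivative_add
          [OF ndiff_SucD[OF Suc.prems(1)] ndiff_SucD[OF Suc.prems(2)]]])
      (use Suc in auto)
qed simp

lemma ndiff_mult: "ndiff k f \<Longrightarrow> ndiff k g \<Longrightarrow> ndiff k (\<lambda>x. f x * g x)"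
proof (induction k arbitrary: f g)
  case (Suc k)
  let ?D = "\<lambda>f x. vector_derivative f (at x)"
  show ?case
  proof (rule ndiff_SucI)
    show "((\<lambda>x. f x * g x) has_vector_derivative f x * ?D g x + ?D f x * g x) (at x)" for x
      by (intro has_vector_derivative_mult ndiff_SucD[OF Suc.prems(1)] ndiff_SucD[OF Suc.prems(2)])
    show "ndiff k (\<lambda>x. f x * ?D g x + ?D f x * g x)"
      using Suc.prems by (intro ndiff_add Suc.IH ndiff_mono[of k f] ndiff_mono[of k g]) auto
  qed
qed simp

text \<open>The derivative of the inverse is a product of the derivative of \<open>g\<close> with
  two copies of the inverse, so the induction hypothesis covers it.\<close>

lemma ndiff_inverse:
  assumes "ndiff k g" "\<And>x. g x \<noteq> 0"
  shows "ndiff k (\<lambda>x. inverse (g x))"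
  using assms(1)
proof (induction k)
  case (Suc k)
  let ?D = "\<lambda>f x. vector_derivative f (at x)"
  show ?case
  proof (rule ndiff_SucI)
    fix x
    have "(inverse has_field_derivative - (inverse (g x) * inverse (g x))) (at (g x))"
      by (rule DERIV_inverse'[OF DERIV_ident assms(2), THEN DERIV_cong]) simp
    from field_vector_diff_chain_at[OF ndiff_SucD[OF Suc.prems] this]
    show "((\<lambda>x. inverse (g x)) has_vector_derivative
        - 1 * (inverse (g x) * inverse (g x) * ?D g x)) (at x)"
      by (simp add: o_def mult_ac)
  next
    show "ndiff k (\<lambda>x. - 1 * (inverse (g x) * inverse (g x) * ?D g x))"
      using Suc.prems by (intro ndiff_mult ndiff_const Suc.IH ndiff_mono[of k g]) auto
  qed
qed simp

lemma ndiff_affine: "ndiff k g \<Longrightarrow> ndiff k (\<lambda>x. g (b * x + c))"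
proof (induction k arbitrary: g)
  case (Suc k)
  show ?case
  proof (rule ndiff_SucI)
    fix x
    have "((\<lambda>x. b * x + c) has_vector_derivative b) (at x)"
      by (auto intro!: derivative_eq_intros simp: has_real_derivative_iff_has_vector_derivative[symmetric])
    from vector_diff_chain_at[OF this ndiff_SucD[OF Suc.prems]]
    show "((\<lambda>x. g (b * x + c)) has_vector_derivative
       of_real b * vector_derivative g (at (b * x + c))) (at x)"
      by (simp add: o_def scaleR_conv_of_real)
  next
    show "ndiff k (\<lambda>x. of_real b * vector_derivative g (at (b * x + c)))"
      using Suc.prems by (intro ndiff_mult ndiff_const Suc.IH) auto
  qed
qed simp

lemma ndiff_exp: "ndiff k (\<lambda>x. exp (z * of_real x))"
proof (induction k)
  case (Suc k)
  show ?case
  proof (rule ndiff_SucI)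
    show "((\<lambda>x. exp (z * of_real x)) has_vector_derivative z * exp (z * of_real x)) (at x)" for x
      by (rule has_vector_derivative_real_field) (auto intro!: derivative_eq_intros)
    show "ndiff k (\<lambda>x. z * exp (z * of_real x))"
      by (intro ndiff_mult ndiff_const Suc.IH)
  qed
qed simp

section \<open>Flat functions and smooth plateaus\<close>

definition flat_fn :: "real poly \<Rightarrow> real \<Rightarrow> real" where
  "flat_fn p x = (if x > 0 then poly p (1 / x) * exp (- (1 / x)) else 0)"

lemma poly_exp_tendsto_0:
  fixes p :: "real poly"
  shows "((\<lambda>x. poly p x * exp (- x)) \<longlongrightarrow> 0) at_top"
proof -
  have "((\<lambda>x. \<Sum>i\<le>degree p. coeff p i * (x ^ i / exp x)) \<longlongrightarrow> (\<Sum>i\<le>degree p. coeff p i * 0)) at_top"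
    by (intro tendsto_intros tendsto_power_div_exp_0)
  moreover have "(\<Sum>i\<le>degree p. coeff p i * (x ^ i / exp x)) = poly p x * exp (- x)" for x
    by (simp add: poly_altdef sum_distrib_left exp_minus divide_inverse mult_ac)
  ultimately show ?thesis by simp
qed

text \<open>With \<open>y = 1 / x\<close>, the derivative of \<open>p(y) exp(- y)\<close> in
  \<open>x\<close> is \<open>(p - p')(y) y^2 exp(- y)\<close>; allowing a polynomial factor thus
  makes the family closed under differentiation. At 0 the difference quotient from the right is
  again a polynomial in \<open>y\<close> times \<open>exp(- y)\<close> and tends to 0.\<close>

lemma flat_fn_deriv:
  "(flat_fn p has_real_derivative flat_fn ((p - pderiv p) * monom 1 2) x) (at x)"
proof -
  consider "x > 0" | "x < 0" | "x = 0" by linarith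
  then show ?thesis
  proof cases
    case 1
    have "((\<lambda>x. poly p (1 / x) * exp (- (1 / x))) has_real_derivative
        flat_fn ((p - pderiv p) * monom 1 2) x) (at x)"
      using 1 by (auto intro!: derivative_eq_intros DERIV_chain2[OF poly_DERIV]
          simp: flat_fn_def poly_monom power2_eq_square field_simps)
    then show ?thesis
      by (rule has_field_derivative_transform_within_open[of _ _ _ "{0<..}"])
        (use 1 in \<open>auto simp: flat_fn_def\<close>)
  next
    case 2
    have "((\<lambda>x. 0) has_real_derivative flat_fn ((p - pderiv p) * monom 1 2) x) (at x)"
      using 2 by (simp add: flat_fn_def)
    then show ?thesis
      by (rule has_field_derivative_transform_within_open[of _ _ _ "{..<0}"])
        (use 2 in \<open>auto simp: flat_fn_def\<close>)
  next
    case 3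
    have r: "((\<lambda>y. flat_fn p y / y) \<longlongrightarrow> 0) (at_right 0)"
    proof -
      \<comment> \<open>\<open>pCons 0 p\<close> is \<open>p\<close> times the variable; the extra
        factor \<open>inverse y\<close> is the division by \<open>y\<close> in the difference
        quotient.\<close>
      have "((\<lambda>y. poly (pCons 0 p) (inverse y) * exp (- inverse y)) \<longlongrightarrow> 0) (at_right (0::real))"
        by (rule filterlim_compose[OF poly_exp_tendsto_0 filterlim_inverse_at_top_right])
      moreover have "\<forall>\<^sub>F y in at_right 0. poly (pCons 0 p) (inverse y) * exp (- inverse y) = flat_fn p y / y"
        unfolding eventually_at_right_field by (intro exI[of _ 1]) (auto simp: flat_fn_def field_simps)
      ultimately show ?thesis by (rule Lim_transform_eventually)
    qed
    have l: "((\<lambda>y. flat_fn p y / y) \<longlongrightarrow> 0) (at_left 0)"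
      by (rule tendsto_eventually, unfold eventually_at_left_field)
        (intro exI[of _ "-1"], auto simp: flat_fn_def)
    from filterlim_split_at[OF l r] show ?thesis
      by (simp add: 3 DERIV_def flat_fn_def)
  qed
qed

lemma ndiff_flat_fn: "ndiff k (\<lambda>x. of_real (flat_fn p x))"
proof (induction k arbitrary: p)
  case (Suc k)
  show ?case
  proof (rule ndiff_SucI)
    show "((\<lambda>x. complex_of_real (flat_fn p x)) has_vector_derivative
        of_real (flat_fn ((p - pderiv p) * monom 1 2) x)) (at x)" for x
      by (rule has_vector_derivative_of_real)
        (simp add: flat_fn_deriv has_real_derivative_iff_has_vector_derivative[symmetric])
  qed (rule Suc.IH)
qed simp

text \<open>The quotient \<open>E x / (E x + E (1 - x))\<close> is a smooth step from 0 to 1, and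
  the plateau is the product of a rising and a falling step.\<close>

lemma smooth_plateau:
  assumes "r > (0::real)"
  obtains g where "\<And>k. ndiff k g" "\<And>x. \<bar>x - c\<bar> \<le> r \<Longrightarrow> g x = 1" "\<And>x. \<bar>x - c\<bar> \<ge> 2 * r \<Longrightarrow> g x = 0"
proof -
  define E where "E = (\<lambda>x. complex_of_real (flat_fn 1 x))"
  define S where "S = (\<lambda>x. E x * inverse (E x + E (- 1 * x + 1)))"
  \<comment> \<open>One of \<open>x\<close> and \<open>1 - x\<close> is always positive.\<close>
  have "flat_fn 1 x + flat_fn 1 (- 1 * x + 1) > 0" for x
    by (cases "x > 0"; cases "x < 1") (auto simp: flat_fn_def intro: add_pos_pos)
  then have ne: "E x + E (- 1 * x + 1) \<noteq> 0" for x
    unfolding E_def of_real_add[symmetric] of_real_eq_0_iff by (metis less_irrefl)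
  have S: "ndiff k S" for k
    unfolding S_def
    by (intro ndiff_mult ndiff_inverse ne ndiff_add ndiff_affine) (simp_all add: E_def ndiff_flat_fn)
  have S0: "S x = 0" if "x \<le> 0" for x using that by (simp add: S_def E_def flat_fn_def)
  have S1: "S x = 1" if "x \<ge> 1" for x
  proof -
    have "E (- 1 * x + 1) = 0" using that by (simp add: E_def flat_fn_def)
    with ne[of x] show ?thesis by (simp add: S_def)
  qed
  \<comment> \<open>The arguments are \<open>2 + (x - c) / r\<close> and
    \<open>2 - (x - c) / r\<close>: both are at least 1 on the inner interval, and one of them is at
    most 0 outside the outer one.\<close>
  define g where "g = (\<lambda>x. S ((1 / r) * x + (2 - c / r)) * S ((- 1 / r) * x + (2 + c / r)))"
  show ?thesis
  proof
    show "ndiff k g" for k unfolding g_def by (intro ndiff_mult ndiff_affine S)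
    show "g x = 1" if "\<bar>x - c\<bar> \<le> r" for x
    proof -
      have "\<bar>(x - c) / r\<bar> \<le> 1" using that assms by simp
      then have "(1 / r) * x + (2 - c / r) \<ge> 1" "(- 1 / r) * x + (2 + c / r) \<ge> 1"
        by (simp_all add: diff_divide_distrib abs_le_iff)
      then show ?thesis by (simp only: g_def S1 mult_1)
    qed
    show "g x = 0" if "\<bar>x - c\<bar> \<ge> 2 * r" for x
    proof (cases "x \<ge> c")
      case True
      then have "(x - c) / r \<ge> 2" using that assms by (simp add: pos_le_divide_eq)
      then have "(- 1 / r) * x + (2 + c / r) \<le> 0" by (simp add: diff_divide_distrib)
      then show ?thesis by (simp add: g_def S0)
    next
      case False
      then have "(x - c) / r \<le> - 2" using that assms by (simp add: pos_divide_le_eq)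
      then have "(1 / r) * x + (2 - c / r) \<le> 0" by (simp add: diff_divide_distrib)
      then show ?thesis by (simp add: g_def S0)
    qed
  qed
qed

section \<open>Products of functions of one variable\<close>

definition tensor_fn :: "nat \<Rightarrow> (nat \<Rightarrow> real \<Rightarrow> complex) \<Rightarrow> (nat \<Rightarrow> real) \<Rightarrow> complex" where
  "tensor_fn m g t = (if t \<in> Rm m then \<Prod>u<m. g u (t u) else 0)"

lemma tensor_fn_deriv:
  assumes "i < m" "t \<in> Rm m" "(g i has_vector_derivative D) (at (t i))"
  shows "((\<lambda>s. tensor_fn m g (t(i := s))) has_vector_derivative
    (\<Prod>u\<in>{..<m} - {i}. g u (t u)) * D) (at (t i))"
proof -
  define c where "c = (\<Prod>u\<in>{..<m} - {i}. g u (t u))"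
  have eq: "tensor_fn m g (t(i := s)) = c * g i s" for s
  proof -
    have "(\<Prod>u\<in>{..<m} - {i}. g u ((t(i := s)) u)) = c"
      unfolding c_def by (rule prod.cong[OF refl]) simp
    then have "(\<Prod>u<m. g u ((t(i := s)) u)) = g i s * c"
      using prod.remove[of "{..<m}" i "\<lambda>u. g u ((t(i := s)) u)"] assms(1) by simp
    moreover have "t(i := s) \<in> Rm m" using assms by (simp only: Rm_upd)
    ultimately show ?thesis by (simp only: tensor_fn_def if_True mult.commute)
  qed
  show ?thesis unfolding eq c_def[symmetric] by (rule has_vector_derivative_mult_right[OF assms(3)])
qed

lemma continuous_on_tensor_fn:
  assumes "\<And>u k. u < m \<Longrightarrow> ndiff k (g u)"
  shows "continuous_on (Rm m) (tensor_fn m g)"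
proof -
  have "continuous_on (Rm m) (\<lambda>t. g u (t u))" if "u < m" for u
  proof (rule continuous_on_compose2[where g = "g u" and t = UNIV])
    show "continuous_on UNIV (g u)"
    proof (rule continuous_at_imp_continuous_on, safe)
      show "isCont (g u) x" for x
        by (rule has_vector_derivative_continuous, rule ndiff_SucD[of 0], rule assms[OF that])
    qed
    show "continuous_on (Rm m) (\<lambda>t. t u)"
      by (rule continuous_on_subset[OF continuous_on_product_coordinates subset_UNIV])
  qed simp
  then have "continuous_on (Rm m) (\<lambda>t. \<Prod>u<m. g u (t u))"
    by (intro continuous_on_prod) simp
  then show ?thesis by (rule continuous_on_eq) (simp add: tensor_fn_def)
qed

lemma pdiff_tensor_fn:
  assumes g: "\<And>k. ndiff k (g i)" and i: "i < m"
  defines "g' \<equiv> g(i := \<lambda>x. vector_derivative (g i) (at x))"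
  shows "pdiff i (tensor_fn m g) = tensor_fn m g'"
    and "t \<in> Rm m \<Longrightarrow> (\<lambda>s. tensor_fn m g (t(i := s))) differentiable (at (t i))"
proof -
  have d: "((\<lambda>s. tensor_fn m g (t(i := s))) has_vector_derivative tensor_fn m g' t) (at (t i))"
    if "t \<in> Rm m" for t
  proof -
    have "tensor_fn m g' t =
        vector_derivative (g i) (at (t i)) * (\<Prod>u\<in>{..<m} - {i}. g' u (t u))"
      using that i prod.remove[of "{..<m}" i "\<lambda>u. g' u (t u)"] by (simp add: tensor_fn_def g'_def)
    also have "(\<Prod>u\<in>{..<m} - {i}. g' u (t u)) = (\<Prod>u\<in>{..<m} - {i}. g u (t u))"
      by (rule prod.cong) (auto simp: g'_def)
    finally have "tensor_fn m g' t =
        (\<Prod>u\<in>{..<m} - {i}. g u (t u)) * vector_derivative (g i) (at (t i))"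
      by (simp only: mult.commute)
    then show ?thesis
      using tensor_fn_deriv[of i m t g, OF i that ndiff_SucD[of 0 "g i", OF g]] by simp
  qed
  show "pdiff i (tensor_fn m g) = tensor_fn m g'"
  proof
    show "pdiff i (tensor_fn m g) t = tensor_fn m g' t" for t
    proof (cases "t \<in> Rm m")
      case True
      then show ?thesis using d unfolding pdiff_def by (intro vector_derivative_at) auto
    next
      case False
      then show ?thesis using pdiff_off[of m "tensor_fn m g"] i by (simp add: tensor_fn_def)
    qed
  qed
  show "t \<in> Rm m \<Longrightarrow> (\<lambda>s. tensor_fn m g (t(i := s))) differentiable (at (t i))"
    using d by (blast intro: differentiableI_vector)
qed

text \<open>A partial derivative of such a product is again such a product, with one factor replaced
  by its derivative, so the induction runs over all families of smooth factors.\<close>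

lemma ck_on_tensor_fn:
  assumes "\<And>u k. u < m \<Longrightarrow> ndiff k (g u)"
  shows "ck_on m k (Rm m) (tensor_fn m g)"
  using assms
proof (induction k arbitrary: g)
  case 0
  then show ?case using continuous_on_tensor_fn by simp
next
  case (Suc k)
  have "ck_on m k (Rm m) (pdiff i (tensor_fn m g))" if "i < m" for i
    unfolding pdiff_tensor_fn(1)[of g i, OF Suc.prems[OF that] that]
  proof (rule Suc.IH)
    show "ndiff l ((g(i := \<lambda>x. vector_derivative (g i) (at x))) u)" if "u < m" for u l
      using Suc.prems[OF that, of l] Suc.prems[OF that, of "Suc l"] by auto
  qed
  moreover have "(\<lambda>s. tensor_fn m g (t(i := s))) differentiable (at (t i))" if "i < m" "t \<in> Rm m" for i t
    by (rule pdiff_tensor_fn(2)[of g i, OF Suc.prems[OF that(1)] that])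
  moreover note continuous_on_tensor_fn[of m g, OF Suc.prems]
  ultimately show ?case unfolding ck_on.simps by blast
qed

text \<open>These are the test functions on which polynomials in the reduced operators act by
  scalars near \<open>t0\<close>. Each factor of the exponential is cut off by a plateau that is 1
  up to distance \<open>\<rho> / 2\<close> from \<open>t0 u\<close> and 0 from distance
  \<open>\<rho>\<close> on; this keeps the support in \<open>K\<close>.\<close>

lemma local_exponential_in_CK:
  assumes "\<rho> > 0" "t0 \<in> Rm m" and box: "\<And>t. \<lbrakk>t \<in> Rm m; \<And>u. u < m \<Longrightarrow> \<bar>t u - t0 u\<bar> < \<rho>\<rbrakk> \<Longrightarrow> t \<in> K"
  obtains \<xi> r where "\<xi> \<in> CK m K" "r > 0"
    "\<And>t. \<lbrakk>t \<in> Rm m; \<And>u. u < m \<Longrightarrow> \<bar>t u - t0 u\<bar> < r\<rbrakk> \<Longrightarrow>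
      \<xi> t = exp (\<Sum>u<m. \<zeta> u * complex_of_real (t u))"
proof -
  have half: "\<rho> / 2 > 0" using assms(1) by simp
  define P where "P u h \<longleftrightarrow> (\<forall>k. ndiff k h) \<and> (\<forall>x. \<bar>x - t0 u\<bar> \<le> \<rho> / 2 \<longrightarrow> h x = 1) \<and>
      (\<forall>x. \<bar>x - t0 u\<bar> \<ge> 2 * (\<rho> / 2) \<longrightarrow> h x = 0)" for u h
  have "\<exists>h. P u h" for u
    by (rule smooth_plateau[OF half, of "t0 u"]) (unfold P_def, blast)
  then have "\<exists>g. \<forall>u. P u (g u)" by (intro choice allI)
  then obtain g where P: "\<And>u. P u (g u)" by blast
  have g: "ndiff k (g u)" "\<bar>x - t0 u\<bar> \<le> \<rho> / 2 \<Longrightarrow> g u x = 1" "\<bar>x - t0 u\<bar> \<ge> \<rho> \<Longrightarrow> g u x = 0" for u k x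
    using P[of u] unfolding P_def by simp_all
  define \<xi> where "\<xi> = tensor_fn m (\<lambda>u x. g u x * exp (\<zeta> u * of_real x))"
  show ?thesis
  proof
    have "\<xi> t = 0" if "t \<notin> K" for t
    proof (cases "t \<in> Rm m")
      case True
      then have "\<not> (\<forall>u<m. \<bar>t u - t0 u\<bar> < \<rho>)" using box[OF True] that by blast
      then obtain u where "u < m" "\<bar>t u - t0 u\<bar> \<ge> \<rho>" by (auto simp: not_less)
      then have "\<exists>u\<in>{..<m}. g u (t u) * exp (\<zeta> u * of_real (t u)) = 0"
        using g(3)[of "t u" u] by (intro bexI[of _ u]) simp_all
      then have "(\<Prod>u<m. g u (t u) * exp (\<zeta> u * of_real (t u))) = 0"
        by (simp only: prod_zero finite_lessThan)
      then show ?thesis using True by (simp add: \<xi>_def tensor_fn_def)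
    qed (simp add: \<xi>_def tensor_fn_def)
    moreover have "ck_on m k (Rm m) \<xi>" for k
      unfolding \<xi>_def by (intro ck_on_tensor_fn ndiff_mult g ndiff_exp)
    ultimately show "\<xi> \<in> CK m K" by (simp add: CK_def smooth_on_def)
    show "\<xi> t = exp (\<Sum>u<m. \<zeta> u * complex_of_real (t u))"
      if "t \<in> Rm m" "\<And>u. u < m \<Longrightarrow> \<bar>t u - t0 u\<bar> < \<rho> / 2" for t
    proof -
      have "g u (t u) = 1" if "u < m" for u
        using g(2)[of "t u" u] \<open>\<And>u. u < m \<Longrightarrow> \<bar>t u - t0 u\<bar> < \<rho> / 2\<close>[OF that] by simp
      then show ?thesis using that(1) by (simp add: \<xi>_def tensor_fn_def exp_sum)
    qed
  qed (use assms in auto)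
qed

text \<open>Differentiation is local, so agreement with the exponential on a box is enough. The
  result has the same shape with \<open>c\<close> replaced by \<open>\<zeta> i * c\<close>, which
  allows iteration.\<close>

lemma pdiff_local_exponential:
  assumes F: "\<And>t. \<lbrakk>t \<in> Rm m; \<And>u. u < m \<Longrightarrow> \<bar>t u - t0 u\<bar> < r\<rbrakk> \<Longrightarrow>
      F t = c * exp (\<Sum>u<m. \<zeta> u * complex_of_real (t u))"
    and t: "t \<in> Rm m" "\<And>u. u < m \<Longrightarrow> \<bar>t u - t0 u\<bar> < r" and i: "i < m"
  shows "pdiff i F t = \<zeta> i * c * exp (\<Sum>u<m. \<zeta> u * complex_of_real (t u))"
proof -
  let ?e = "\<lambda>s. c * exp (\<Sum>u<m. \<zeta> u * complex_of_real ((t(i := s)) u))"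
  have sum: "(\<Sum>u<m. \<zeta> u * complex_of_real ((t(i := s)) u)) =
      \<zeta> i * of_real s + (\<Sum>u\<in>{..<m} - {i}. \<zeta> u * complex_of_real (t u))" for s
    using i by (subst sum.remove[of _ i]) (auto intro!: sum.cong)
  have "(?e has_vector_derivative \<zeta> i * c * exp (\<Sum>u<m. \<zeta> u * complex_of_real (t u))) (at (t i))"
    unfolding sum using sum[of "t i"]
    by (intro has_vector_derivative_real_field) (auto intro!: derivative_eq_intros)
  then have "((\<lambda>s. F (t(i := s))) has_vector_derivative
      \<zeta> i * c * exp (\<Sum>u<m. \<zeta> u * complex_of_real (t u))) (at (t i))"
  proof (rule has_vector_derivative_transform_within_open)
    show "open (ball (t0 i) r)" "t i \<in> ball (t0 i) r"
      using t i by (auto simp: dist_real_def abs_minus_commute)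
    show "?e s = F (t(i := s))" if "s \<in> ball (t0 i) r" for s
    proof (rule F[symmetric])
      show "t(i := s) \<in> Rm m" using t(1) i by (simp only: Rm_upd)
      show "\<bar>(t(i := s)) u - t0 u\<bar> < r" if "u < m" for u
        using t(2)[OF that] \<open>s \<in> ball (t0 i) r\<close> by (auto simp: dist_real_def abs_minus_commute)
    qed
  qed
  then show ?thesis unfolding pdiff_def by (rule vector_derivative_at)
qed

section \<open>The action modulo \<open>\<nu>\<close>\<close>

definition tens_op ::
  "('i \<Rightarrow> ('x \<Rightarrow> complex) \<Rightarrow> 'x \<Rightarrow> complex) \<Rightarrow> 'i tens_alg \<Rightarrow> ('x \<Rightarrow> complex) \<Rightarrow> 'x \<Rightarrow> complex" where
  "tens_op L T F x =
    (\<Sum>w\<in>Poly_Mapping.keys T. Poly_Mapping.lookup T w * foldr L (letters w) F x)"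

lemma tens_op_superset:
  assumes "finite A" "Poly_Mapping.keys T \<subseteq> A"
  shows "tens_op L T F x = (\<Sum>w\<in>A. Poly_Mapping.lookup T w * foldr L (letters w) F x)"
  unfolding tens_op_def
  by (rule sum.mono_neutral_left) (use assms in \<open>auto simp: in_keys_iff\<close>)

lemma tens_op_add: "tens_op L (S + T) F x = tens_op L S F x + tens_op L T F x"
proof -
  let ?A = "Poly_Mapping.keys S \<union> Poly_Mapping.keys T"
  have "Poly_Mapping.keys (S + T) \<subseteq> ?A" by (rule Poly_Mapping.keys_add)
  then show ?thesis
    by (simp add: tens_op_superset[of ?A] lookup_add algebra_simps sum.distrib)
qed

lemma tens_op_zero: "tens_op L 0 F x = 0"
  by (simp add: tens_op_def)

lemma tens_op_uminus: "tens_op L (- T) F x = - tens_op L T F x"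
  using tens_op_add[of L T "- T" F x] by (simp add: tens_op_zero eq_neg_iff_add_eq_0 add.commute)

lemma tens_op_diff: "tens_op L (S - T) F x = tens_op L S F x - tens_op L T F x"
  using tens_op_add[of L S "- T" F x] by (simp add: tens_op_uminus)

lemma tens_op_sum: "tens_op L (\<Sum>a\<in>A. T a) F x = (\<Sum>a\<in>A. tens_op L (T a) F x)"
  by (induction A rule: infinite_finite_induct) (simp_all add: tens_op_zero tens_op_add)

lemma tens_op_single: "tens_op L (Poly_Mapping.single w c) F x = c * foldr L (letters w) F x"
  by (simp add: tens_op_def)

lemma poly_mapping_eq_sum_single:
  "T = (\<Sum>w\<in>Poly_Mapping.keys T. Poly_Mapping.single w (Poly_Mapping.lookup T w))"
proof (rule poly_mapping_eqI)
  fix v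
  have "(\<Sum>w\<in>Poly_Mapping.keys T. Poly_Mapping.lookup T w when w = v) =
      (\<Sum>w\<in>Poly_Mapping.keys T. if w = v then Poly_Mapping.lookup T w else 0)"
    by (rule sum.cong) (auto simp: when_def)
  then show "Poly_Mapping.lookup T v = Poly_Mapping.lookup
      (\<Sum>w\<in>Poly_Mapping.keys T. Poly_Mapping.single w (Poly_Mapping.lookup T w)) v"
    by (simp add: lookup_sum lookup_single in_keys_iff)
qed

text \<open>Linearity and commutation are confined to an invariant space \<open>C\<close> because,
  for the operators in question, partial derivatives of functions that lack them have arbitrary
  values.\<close>

locale commuting_operators =
  fixes C :: "('x \<Rightarrow> complex) set" and L :: "'i::finite \<Rightarrow> ('x \<Rightarrow> complex) \<Rightarrow> 'x \<Rightarrow> complex"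
  assumes zero_mem: "(\<lambda>x. 0) \<in> C"
    and lin_mem: "F \<in> C \<Longrightarrow> G \<in> C \<Longrightarrow> (\<lambda>x. c * F x + G x) \<in> C"
    and L_mem: "F \<in> C \<Longrightarrow> L i F \<in> C"
    and L_lin: "F \<in> C \<Longrightarrow> G \<in> C \<Longrightarrow> L i (\<lambda>x. c * F x + G x) = (\<lambda>x. c * L i F x + L i G x)"
    and L_comm: "F \<in> C \<Longrightarrow> L i (L j F) = L j (L i F)"
begin

lemma foldr_mem: "F \<in> C \<Longrightarrow> foldr L ws F \<in> C"
  by (induction ws) (auto intro: L_mem)

lemma foldr_lin:
  "F \<in> C \<Longrightarrow> G \<in> C \<Longrightarrow> foldr L ws (\<lambda>x. c * F x + G x) = (\<lambda>x. c * foldr L ws F x + foldr L ws G x)"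
  by (induction ws) (simp_all add: L_lin foldr_mem)

text \<open>For \<open>c = - 1\<close> and two zero functions, linearity expresses the value as
  \<open>- y + y\<close>.\<close>

lemma foldr_zero: "foldr L ws (\<lambda>x. 0) = (\<lambda>x. 0)"
  using foldr_lin[OF zero_mem zero_mem, of ws "- 1"] by simp

lemma sum_mem: "(\<And>a. a \<in> A \<Longrightarrow> F a \<in> C) \<Longrightarrow> (\<lambda>x. \<Sum>a\<in>A. c a * F a x) \<in> C"
  by (induction A rule: infinite_finite_induct) (auto intro: zero_mem lin_mem)

lemma foldr_sum:
  "(\<And>a. a \<in> A \<Longrightarrow> F a \<in> C) \<Longrightarrow>
    foldr L ws (\<lambda>x. \<Sum>a\<in>A. c a * F a x) = (\<lambda>x. \<Sum>a\<in>A. c a * foldr L ws (F a) x)"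
  by (induction A rule: infinite_finite_induct) (simp_all add: foldr_zero foldr_lin sum_mem)

lemma tens_op_mem: "F \<in> C \<Longrightarrow> tens_op L T F \<in> C"
  unfolding tens_op_def[abs_def] by (intro sum_mem foldr_mem)

text \<open>Once both factors are sums of words, the product concatenates words and
  \<open>foldr\<close> composes the operators; linearity on \<open>C\<close> then moves the inner
  sum through the outer word.\<close>

lemma tens_op_mult:
  assumes "F \<in> C"
  shows "tens_op L (S * T) F x = tens_op L S (tens_op L T F) x"
proof -
  let ?kS = "Poly_Mapping.keys S" and ?kT = "Poly_Mapping.keys T"
  let ?s = "Poly_Mapping.lookup S" and ?t = "Poly_Mapping.lookup T"
  have "S * T = (\<Sum>v\<in>?kS. \<Sum>w\<in>?kT. Poly_Mapping.single (v + w) (?s v * ?t w))"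
    by (subst poly_mapping_eq_sum_single[of S], subst poly_mapping_eq_sum_single[of T])
      (simp add: sum_product mult_single)
  then have "tens_op L (S * T) F x =
      (\<Sum>v\<in>?kS. \<Sum>w\<in>?kT. ?s v * ?t w * foldr L (letters v) (foldr L (letters w) F) x)"
    by (simp add: tens_op_sum tens_op_single plus_tword_def)
  also have "\<dots> = (\<Sum>v\<in>?kS. ?s v * foldr L (letters v) (tens_op L T F) x)"
  proof (rule sum.cong[OF refl])
    fix v
    have "foldr L (letters v) (tens_op L T F) =
        (\<lambda>x. \<Sum>w\<in>?kT. ?t w * foldr L (letters v) (foldr L (letters w) F) x)"
      unfolding tens_op_def[abs_def] by (intro foldr_sum foldr_mem assms)
    then show "(\<Sum>w\<in>?kT. ?s v * ?t w * foldr L (letters v) (foldr L (letters w) F) x) =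
        ?s v * foldr L (letters v) (tens_op L T F) x"
      by (simp add: sum_distrib_left mult.assoc)
  qed
  finally show ?thesis by (simp add: tens_op_def[of L S])
qed

lemma tens_op_zero_fn: "tens_op L T (\<lambda>x. 0) x = 0"
  by (simp add: tens_op_def foldr_zero)

lemma tens_op_commutator:
  fixes y z :: "complex ^ 'i"
  assumes "F \<in> C"
  shows "tens_op L (tens_vec y * tens_vec z - tens_vec z * tens_vec y) F = (\<lambda>x. 0)"
proof
  fix x
  have *: "tens_op L (tens_vec y * tens_vec z) F x =
      (\<Sum>i\<in>UNIV. \<Sum>j\<in>UNIV. y $ i * z $ j * L i (L j F) x)" for y z :: "complex ^ 'i"
    unfolding tens_vec_def sum_product mult_single
    by (simp add: tens_op_sum tens_op_single plus_tword_def)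
  have "(\<Sum>i\<in>UNIV. \<Sum>j\<in>UNIV. z $ i * y $ j * L i (L j F) x) =
      (\<Sum>i\<in>UNIV. \<Sum>j\<in>UNIV. y $ i * z $ j * L i (L j F) x)"
    by (subst sum.swap) (simp add: L_comm[OF assms] mult_ac)
  then show "tens_op L (tens_vec y * tens_vec z - tens_vec z * tens_vec y) F x = 0"
    by (simp add: tens_op_diff *)
qed

text \<open>At order 0 the term with \<open>fps_X\<close> disappears, so a generator reduces to a
  commutator of two vectors, which acts by zero. Multiplicativity extends this to its multiples by
  \<open>A\<close> and \<open>B\<close>.\<close>

lemma tens_op_deform_ideal:
  assumes "R \<in> deform_ideal br" "F \<in> C"
  shows "tens_op L (fps_nth R 0) F x = 0"
  using assms(1)
proof induction
  case zero
  show ?case by (simp add: tens_op_zero)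
next
  case (step S A y z B)
  let ?Z = "tens_vec y * tens_vec z - tens_vec z * tens_vec y"
  have "tens_op L (?Z * fps_nth B 0) F = (\<lambda>x. 0)"
    by (rule ext) (simp only: tens_op_mult[OF assms(2)] tens_op_commutator[OF tens_op_mem[OF assms(2)]])
  then have "tens_op L (fps_nth A 0 * ?Z * fps_nth B 0) F x = tens_op L (fps_nth A 0) (\<lambda>x. 0) x"
    by (simp only: tens_op_mult[OF assms(2)] mult.assoc)
  then show ?case using step.IH
    by (simp add: tens_op_add tens_op_zero_fn)
qed

end

text \<open>Series at distance less than 1 share their coefficient of order 0, so taking the
  \<open>\<nu>\<close>-adic closure adds nothing modulo \<open>\<nu>\<close>.\<close>

lemma fps_closure_nth_0:
  assumes "S \<in> closure D"
  shows "\<exists>R\<in>D. fps_nth R 0 = fps_nth S 0"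
proof -
  have "(0::real) < inverse (2 ^ 0)" by simp
  then obtain R where "R \<in> D" "dist R S < inverse (2 ^ 0)"
    using assms unfolding closure_approachable by blast
  then show ?thesis using dist_less_imp_nth_equal[of R S 0 0] by auto
qed

section \<open>First-order operators with constant coefficients\<close>

definition first_order_op ::
  "nat \<Rightarrow> (nat \<Rightarrow> complex) \<Rightarrow> complex \<Rightarrow> ((nat \<Rightarrow> real) \<Rightarrow> complex) \<Rightarrow> (nat \<Rightarrow> real) \<Rightarrow> complex" where
  "first_order_op m b c F t = (\<Sum>u<m. b u * pdiff u F t) + c * F t"

lemma smooth_fns_sum:
  "(\<And>a. a \<in> A \<Longrightarrow> F a \<in> smooth_fns m) \<Longrightarrow> (\<lambda>x. \<Sum>a\<in>A. c a * F a x) \<in> smooth_fns m"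
  by (induction A rule: infinite_finite_induct) (auto intro: zero_smooth_fns smooth_fns_lin)

lemma pdiff_sum_smooth_fns:
  assumes "\<And>a. a \<in> A \<Longrightarrow> F a \<in> smooth_fns m" "i < m"
  shows "pdiff i (\<lambda>x. \<Sum>a\<in>A. c a * F a x) = (\<lambda>x. \<Sum>a\<in>A. c a * pdiff i (F a) x)"
  using assms
proof (induction A rule: infinite_finite_induct)
  case (insert a A)
  then show ?case by (simp add: pdiff_lin_smooth_fns[of _ m] smooth_fns_sum)
qed (simp_all add: pdiff_def[abs_def])

lemma first_order_op_smooth_fns:
  assumes "F \<in> smooth_fns m"
  shows "first_order_op m b c F \<in> smooth_fns m"
proof -
  have "(\<lambda>t. c * F t + (\<Sum>u<m. b u * pdiff u F t)) \<in> smooth_fns m"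
    by (intro smooth_fns_lin smooth_fns_sum pdiff_smooth_fns assms) auto
  then show ?thesis by (simp add: first_order_op_def[abs_def] add.commute)
qed

lemma first_order_op_lin:
  assumes "F \<in> smooth_fns m" "G \<in> smooth_fns m"
  shows "first_order_op m b c (\<lambda>t. k * F t + G t) =
    (\<lambda>t. k * first_order_op m b c F t + first_order_op m b c G t)"
proof
  fix t
  have "(\<Sum>u<m. b u * pdiff u (\<lambda>t. k * F t + G t) t) =
      k * (\<Sum>u<m. b u * pdiff u F t) + (\<Sum>u<m. b u * pdiff u G t)"
    using pdiff_lin_smooth_fns[OF assms]
    by (simp add: sum_distrib_left distrib_left sum.distrib mult_ac)
  then show "first_order_op m b c (\<lambda>t. k * F t + G t) t =
      k * first_order_op m b c F t + first_order_op m b c G t"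
    by (simp add: first_order_op_def algebra_simps)
qed

lemma pdiff_first_order_op:
  assumes "F \<in> smooth_fns m" "i < m"
  shows "pdiff i (first_order_op m b c F) = first_order_op m b c (pdiff i F)"
proof -
  have "pdiff i (\<lambda>t. c * F t + (\<Sum>u<m. b u * pdiff u F t)) =
      (\<lambda>t. c * pdiff i F t + pdiff i (\<lambda>t. \<Sum>u<m. b u * pdiff u F t) t)"
    by (intro pdiff_lin_smooth_fns[of _ m] smooth_fns_sum pdiff_smooth_fns assms) auto
  also have "pdiff i (\<lambda>t. \<Sum>u<m. b u * pdiff u F t) = (\<lambda>t. \<Sum>u<m. b u * pdiff i (pdiff u F) t)"
    by (intro pdiff_sum_smooth_fns[of _ _ m] pdiff_smooth_fns assms) auto
  also have "\<dots> = (\<lambda>t. \<Sum>u<m. b u * pdiff u (pdiff i F) t)"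
    using pdiff_commute[OF assms(1)] assms(2) by (intro ext sum.cong refl) simp
  finally show ?thesis by (simp add: first_order_op_def[abs_def] add.commute)
qed

text \<open>Both sides expand to the same second-order sum, by the symmetry of mixed derivatives,
  and to lower-order terms in which the two operators play symmetric roles.\<close>

lemma first_order_op_commute:
  assumes "F \<in> smooth_fns m"
  shows "first_order_op m b c (first_order_op m b' c' F) = first_order_op m b' c' (first_order_op m b c F)"
proof
  fix t
  have "first_order_op m b c (first_order_op m b' c' F) t =
     (\<Sum>u<m. b u * first_order_op m b' c' (pdiff u F) t) + c * first_order_op m b' c' F t"
    by (simp add: first_order_op_def[of m b c] pdiff_first_order_op assms)
  also have "\<dots> = (\<Sum>u<m. \<Sum>v<m. b u * b' v * pdiff v (pdiff u F) t)
      + (\<Sum>u<m. b u * c' * pdiff u F t) + c * first_order_op m b' c' F t"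
    by (simp add: first_order_op_def[of m b' c' "pdiff _ F"] distrib_left sum.distrib sum_distrib_left mult_ac)
  also have "(\<Sum>u<m. \<Sum>v<m. b u * b' v * pdiff v (pdiff u F) t) =
      (\<Sum>v<m. \<Sum>u<m. b u * b' v * pdiff u (pdiff v F) t)"
    by (subst sum.swap) (auto intro!: sum.cong simp: pdiff_commute[OF assms])
  also have "\<dots> + (\<Sum>u<m. b u * c' * pdiff u F t) + c * first_order_op m b' c' F t =
      (\<Sum>v<m. \<Sum>u<m. b' v * b u * pdiff u (pdiff v F) t)
      + (\<Sum>v<m. b' v * c * pdiff v F t) + c' * first_order_op m b c F t"
    by (simp add: first_order_op_def distrib_left sum_distrib_left mult_ac)
  also have "\<dots> = (\<Sum>v<m. b' v * first_order_op m b c (pdiff v F) t) + c' * first_order_op m b c F t"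
    by (simp add: first_order_op_def[of m b c "pdiff _ F"] distrib_left sum.distrib sum_distrib_left mult_ac)
  also have "\<dots> = first_order_op m b' c' (first_order_op m b c F) t"
    by (simp add: first_order_op_def[of m b' c'] pdiff_first_order_op assms)
  finally show "first_order_op m b c (first_order_op m b' c' F) t =
    first_order_op m b' c' (first_order_op m b c F) t" .
qed

lemma commuting_first_order_ops:
  "commuting_operators (smooth_fns m) (\<lambda>i. first_order_op m (b i) (c i))"
  by unfold_locales
    (auto intro: zero_smooth_fns smooth_fns_lin first_order_op_smooth_fns first_order_op_lin
      first_order_op_commute)

section \<open>Reduction of the representation\<close>

definition pi0 ::
  "nat \<Rightarrow> ('n::finite vec \<Rightarrow> nat \<Rightarrow> (nat \<Rightarrow> complex) \<Rightarrow> complex) \<Rightarrow>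
   ('n vec \<Rightarrow> (nat \<Rightarrow> complex) \<Rightarrow> complex) \<Rightarrow> 'n \<Rightarrow>
   ((nat \<Rightarrow> real) \<Rightarrow> complex) \<Rightarrow> (nat \<Rightarrow> real) \<Rightarrow> complex" where
  "pi0 m a a0 i =
     first_order_op m (\<lambda>u. \<i> * a (axis i 1) u (\<lambda>j. 0)) (a0 (axis i 1) (\<lambda>j. 0))"

text \<open>At \<open>\<nu> = 0\<close> the coefficients are evaluated at the origin, and the
  divergence term drops out because it carries a factor \<open>\<nu>\<close>.\<close>

lemma pi_op_nth_0:
  "fps_nth (pi_op m a a0 (axis i 1) \<xi> t) 0 = pi0 m a a0 i (\<lambda>t. fps_nth (\<xi> t) 0) t"
  by (simp add: pi_op_def pi0_def first_order_op_def expand_at_def fps_pdiff_def fps_sum_nth)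

lemma tens_act_nth_0:
  "fps_nth (tens_act m a a0 T \<xi> t) 0 = tens_op (pi0 m a a0) T (\<lambda>t. fps_nth (\<xi> t) 0) t"
proof -
  have "(\<lambda>t. fps_nth (foldr (\<lambda>i. pi_op m a a0 (axis i 1)) ws \<xi> t) 0) =
      foldr (pi0 m a a0) ws (\<lambda>t. fps_nth (\<xi> t) 0)" for ws
    by (induction ws) (simp_all add: pi_op_nth_0)
  from fun_cong[OF this] show ?thesis
    by (simp add: tens_act_def tens_op_def fps_sum_nth)
qed

lemma diff_op_1: "diff_op 1 P = P"
proof -
  have "diff_op 1 P = (\<Sum>\<beta>\<in>Poly_Mapping.keys P. Poly_Mapping.single \<beta> (Poly_Mapping.lookup P \<beta>))"
    by (simp add: diff_op_def lookup_one)
  then show ?thesis using poly_mapping_eq_sum_single[of P] by simp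
qed

text \<open>The series for the square root of \<open>J\<close> has constant term 1, so the Duflo map
  reduces to symmetrization modulo \<open>\<nu>\<close>.\<close>

lemma apply_sqrtJ_nth_0: "fps_nth (apply_sqrtJ br u) 0 = fps_nth u 0"
  by (simp add: apply_sqrtJ_def duflo_sqrtJ_def diff_op_1)

text \<open>The action uses an arbitrary representative \<open>S\<close> of the coset. It differs
  from the canonical one, \<open>T\<close>, by an element of the closed ideal, whose coefficient of
  order 0 acts by zero; so \<open>T\<close> may be used instead.\<close>

lemma alg_act_nth_0:
  assumes "(\<lambda>t. fps_nth (\<xi> t) 0) \<in> smooth_fns m"
  shows "fps_nth (alg_act br m a a0 u \<xi> t) 0 =
    tens_op (pi0 m a a0) (symmetrize (fps_nth u 0)) (\<lambda>t. fps_nth (\<xi> t) 0) t"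
proof -
  interpret commuting_operators "smooth_fns m" "pi0 m a a0"
    unfolding pi0_def[abs_def] by (rule commuting_first_order_ops)
  define T where "T = Abs_fps (\<lambda>n. symmetrize (fps_nth (apply_sqrtJ br u) n))"
  define S where "S = (SOME S. S \<in> duflo br u)"
  have "0 \<in> closure (deform_ideal br)"
    using closure_subset deform_ideal.zero by blast
  then have "T \<in> duflo br u" by (simp add: duflo_def U_rel_def T_def)
  then have "S \<in> duflo br u" unfolding S_def by (rule someI)
  then have "T - S \<in> closure (deform_ideal br)" by (simp add: duflo_def U_rel_def T_def)
  from fps_closure_nth_0[OF this] obtain R where "R \<in> deform_ideal br"
    "fps_nth R 0 = fps_nth T 0 - fps_nth S 0" by auto
  then have "tens_op (pi0 m a a0) (fps_nth T 0 - fps_nth S 0) (\<lambda>t. fps_nth (\<xi> t) 0) t = 0"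
    using tens_op_deform_ideal[OF _ assms] by metis
  then show ?thesis
    by (simp add: alg_act_def tens_fps_act_def tens_act_nth_0 tens_op_diff apply_sqrtJ_nth_0
        T_def flip: S_def)
qed

section \<open>The annihilator modulo \<open>\<nu>\<close>\<close>

lemma CK_smooth_fns: "K \<subseteq> Rm m \<Longrightarrow> CK m K \<subseteq> smooth_fns m"
  by (auto simp: CK_def smooth_fns_def)

text \<open>The reduced action depends only on the terms of order 0 of \<open>u\<close> and
  \<open>\<xi>\<close>, and all of these are reached by the constant series
  \<open>fps_const P\<close> and \<open>fps_const (F t)\<close>.\<close>

lemma classical_annihilator_iff:
  assumes "K \<subseteq> Rm m"
  shows "P \<in> classical_annihilator br m a a0 K \<longleftrightarrow>
    (\<forall>F\<in>CK m K. \<forall>t. tens_op (pi0 m a a0) (symmetrize P) F t = 0)"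
proof
  assume P: "P \<in> classical_annihilator br m a a0 K"
  show "\<forall>F\<in>CK m K. \<forall>t. tens_op (pi0 m a a0) (symmetrize P) F t = 0"
  proof (intro ballI allI)
    fix F t assume F: "F \<in> CK m K"
    have "(\<lambda>t. 0) \<in> CK m K"
      using zero_smooth_fns by (simp add: CK_def smooth_fns_def)
    then have "(\<lambda>t. fps_nth (fps_const (F t)) n) \<in> CK m K" for n
      using F by (cases "n = 0") simp_all
    then have "(\<lambda>t. fps_const (F t)) \<in> nu_module m K"
      unfolding nu_module_def by blast
    moreover have "fps_nth (fps_const P) 0 = P" by simp
    ultimately have "fps_nth (alg_act br m a a0 (fps_const P) (\<lambda>t. fps_const (F t)) t) 0 = 0"
      using P unfolding classical_annihilator_def by blast
    then show "tens_op (pi0 m a a0) (symmetrize P) F t = 0"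
      using CK_smooth_fns[OF assms] F by (subst (asm) alg_act_nth_0) auto
  qed
next
  assume *: "\<forall>F\<in>CK m K. \<forall>t. tens_op (pi0 m a a0) (symmetrize P) F t = 0"
  show "P \<in> classical_annihilator br m a a0 K"
    unfolding classical_annihilator_def
  proof (intro CollectI allI impI ballI)
    fix u \<xi> t assume "fps_nth u 0 = P" "\<xi> \<in> nu_module m K"
    then have "(\<lambda>t. fps_nth (\<xi> t) 0) \<in> CK m K" by (simp add: nu_module_def)
    then show "fps_nth (alg_act br m a a0 u \<xi> t) 0 = 0"
      using * CK_smooth_fns[OF assms] \<open>fps_nth u 0 = P\<close> by (subst alg_act_nth_0) auto
  qed
qed

section \<open>Symmetrization and evaluation\<close>

lemma arrangements_finite_nonempty:
  fixes \<beta> :: "'n::finite \<Rightarrow>\<^sub>0 nat"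
  shows "finite (arrangements \<beta>)" "arrangements \<beta> \<noteq> {}"
proof -
  define M where "M = Abs_multiset (Poly_Mapping.lookup \<beta>)"
  have M: "count M = Poly_Mapping.lookup \<beta>"
    unfolding M_def by (rule Abs_multiset_inverse) simp
  \<comment> \<open>Arrangements are the lists with a prescribed multiset of letters. Since there is
    at least one and only finitely many, the denominators in \<open>symmetrize\<close> are not
    zero.\<close>
  have eq: "arrangements \<beta> = TWord ` {ws. mset ws = M}"
  proof (intro set_eqI iffI)
    fix w assume "w \<in> arrangements \<beta>"
    then have "mset (letters w) = M"
      by (intro multiset_eqI) (simp add: arrangements_def M count_mset)
    then show "w \<in> TWord ` {ws. mset ws = M}"
      by (intro image_eqI[of _ _ "letters w"]) simp_all
  qed (auto simp: arrangements_def M[symmetric] count_mset)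
  obtain ws where "mset ws = M" using ex_mset by blast
  then have "{ws. mset ws = M} \<noteq> {}" by blast
  moreover have "finite {ws. mset ws = M}"
    by (rule finite_subset[OF _ finite_lists_length_eq[of UNIV "size M"]]) auto
  ultimately show "finite (arrangements \<beta>)" "arrangements \<beta> \<noteq> {}"
    unfolding eq by simp_all
qed

lemma tens_op_symmetrize:
  "tens_op L (symmetrize P) F t = (\<Sum>\<beta>\<in>Poly_Mapping.keys P. Poly_Mapping.lookup P \<beta> *
     ((\<Sum>w\<in>arrangements \<beta>. foldr L (letters w) F t) / of_nat (card (arrangements \<beta>))))"
  by (simp add: symmetrize_def tens_op_sum tens_op_single sum_distrib_left sum_divide_distrib)

lemma prod_list_eq_prod_power_count:
  fixes l :: "'n::finite \<Rightarrow> 'a::comm_monoid_mult"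
  shows "prod_list (map l ws) = (\<Prod>i\<in>UNIV. l i ^ count_list ws i)"
proof (induction ws)
  case (Cons j ws)
  have "(\<Prod>i\<in>UNIV. l i ^ count_list (j # ws) i) =
      (\<Prod>i\<in>UNIV. (if i = j then l i else 1) * l i ^ count_list ws i)"
    by (rule prod.cong) auto
  also have "\<dots> = l j * (\<Prod>i\<in>UNIV. l i ^ count_list ws i)"
    by (simp add: prod.distrib)
  finally show ?case using Cons.IH by simp
qed simp

text \<open>All arrangements of a monomial contribute the same scalar, so the average disappears and
  \<open>P\<close> acts by its value at the point of eigenvalues.\<close>

lemma tens_op_symmetrize_eigen:
  assumes "\<And>ws. foldr L ws F t = prod_list (map l ws) * e"
  shows "tens_op L (symmetrize P) F t = sym_eval P (\<chi> i. l i) * e"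
proof -
  have "(\<Sum>w\<in>arrangements \<beta>. foldr L (letters w) F t) / of_nat (card (arrangements \<beta>)) =
      (\<Prod>i\<in>UNIV. l i ^ Poly_Mapping.lookup \<beta> i) * e" for \<beta>
  proof -
    have "(\<Sum>w\<in>arrangements \<beta>. foldr L (letters w) F t) =
        (\<Sum>w\<in>arrangements \<beta>. (\<Prod>i\<in>UNIV. l i ^ Poly_Mapping.lookup \<beta> i) * e)"
      by (rule sum.cong) (simp_all add: assms prod_list_eq_prod_power_count arrangements_def)
    then show ?thesis using arrangements_finite_nonempty[of \<beta>] by simp
  qed
  then show ?thesis
    by (simp add: tens_op_symmetrize sym_eval_def sum_distrib_right mult.assoc)
qed

text \<open>Polynomials of degree at most one; those in the annihilator provide the affine equations
  of the variety.\<close>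

definition affine_poly :: "('n::finite \<Rightarrow> complex) \<Rightarrow> complex \<Rightarrow> 'n sym_alg" where
  "affine_poly x c = (\<Sum>j\<in>UNIV. Poly_Mapping.single (Poly_Mapping.single j 1) (x j))
     + Poly_Mapping.single 0 c"

lemma single_inj: "Poly_Mapping.single j (Suc 0) = Poly_Mapping.single k (Suc 0) \<longleftrightarrow> j = k"
  by (metis lookup_single_eq lookup_single_not_eq nat.distinct(1))

text \<open>The weight \<open>\<Phi>\<close> is arbitrary so that evaluation and symmetrized action
  are both instances. Enlarging the support to all monomials of degree at most one avoids a case
  distinction on vanishing coefficients.\<close>

lemma affine_poly_sum:
  fixes x :: "'n::finite \<Rightarrow> complex" and \<Phi> :: "('n \<Rightarrow>\<^sub>0 nat) \<Rightarrow> complex"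
  shows "(\<Sum>\<beta>\<in>Poly_Mapping.keys (affine_poly x c). Poly_Mapping.lookup (affine_poly x c) \<beta> * \<Phi> \<beta>) =
    (\<Sum>j\<in>UNIV. x j * \<Phi> (Poly_Mapping.single j 1)) + c * \<Phi> 0"
proof -
  let ?s = "\<lambda>j::'n. Poly_Mapping.single j (1::nat)"
  let ?l = "Poly_Mapping.lookup (affine_poly x c)"
  have ne: "?s j \<noteq> 0" "0 \<noteq> ?s j" for j
    by (metis lookup_single_eq lookup_zero zero_neq_one)+
  have coeff: "?l \<beta> = (\<Sum>j\<in>UNIV. x j when ?s j = \<beta>) + (c when 0 = \<beta>)" for \<beta>
    by (simp only: affine_poly_def lookup_add lookup_sum lookup_single)
  have "inj ?s" by (simp add: inj_on_def single_inj)
  have sub: "Poly_Mapping.keys (affine_poly x c) \<subseteq> insert 0 (range ?s)"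
  proof
    fix \<beta> assume "\<beta> \<in> Poly_Mapping.keys (affine_poly x c)"
    then have "?l \<beta> \<noteq> 0" by (simp only: in_keys_iff not_False_eq_True)
    show "\<beta> \<in> insert 0 (range ?s)"
    proof (rule ccontr)
      assume "\<not> ?thesis"
      then have "?s j \<noteq> \<beta>" "0 \<noteq> \<beta>" for j by blast+
      then have "?l \<beta> = 0" unfolding coeff by (simp only: when_simps sum.neutral_const) simp
      with \<open>?l \<beta> \<noteq> 0\<close> show False ..
    qed
  qed
  have l0: "?l 0 = c"
    unfolding coeff by (simp only: ne when_simps sum.neutral_const add_0 simp_thms)
  have ls: "?l (?s j) = x j" for j
  proof -
    have "(x k when ?s k = ?s j) = (if k = j then x k else 0)" for k
      by (simp add: single_inj when_def)
    then show ?thesis unfolding coeff by (simp only: ne when_simps) simp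
  qed
  have "(\<Sum>\<beta>\<in>Poly_Mapping.keys (affine_poly x c). ?l \<beta> * \<Phi> \<beta>) = (\<Sum>\<beta>\<in>insert 0 (range ?s). ?l \<beta> * \<Phi> \<beta>)"
    by (rule sum.mono_neutral_left) (use sub in \<open>auto simp: in_keys_iff\<close>)
  also have "\<dots> = c * \<Phi> 0 + (\<Sum>\<beta>\<in>range ?s. ?l \<beta> * \<Phi> \<beta>)"
    by (subst sum.insert) (use ne l0 in auto)
  also have "(\<Sum>\<beta>\<in>range ?s. ?l \<beta> * \<Phi> \<beta>) = (\<Sum>j\<in>UNIV. x j * \<Phi> (?s j))"
    by (subst sum.reindex[OF \<open>inj ?s\<close>]) (simp only: ls o_def)
  finally show ?thesis by simp
qed

lemma sym_eval_affine_poly: "sym_eval (affine_poly x c) z = (\<Sum>j\<in>UNIV. x j * z $ j) + c"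
proof -
  have "(\<Prod>i\<in>UNIV. (z $ i) ^ Poly_Mapping.lookup (Poly_Mapping.single j (1::nat)) i) = z $ j" for j
  proof -
    have "(z $ i) ^ Poly_Mapping.lookup (Poly_Mapping.single j (1::nat)) i = (if i = j then z $ i else 1)" for i
      by (simp add: lookup_single when_def)
    then show ?thesis by simp
  qed
  then show ?thesis unfolding sym_eval_def affine_poly_sum by simp
qed

lemma count_list_eq_singleton:
  assumes "\<And>i. count_list ws i = (if i = j then 1 else 0)"
  shows "ws = [j]"
proof -
  have "mset ws = {#j#}" by (rule multiset_eqI) (simp add: count_mset assms)
  then show ?thesis by simp
qed

text \<open>A monomial of degree at most one has a single arrangement, so symmetrization does not
  affect it.\<close>

lemma tens_op_symmetrize_affine_poly:
  "tens_op L (symmetrize (affine_poly x c)) F t = (\<Sum>j\<in>UNIV. x j * L j F t) + c * F t"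
proof -
  have "arrangements (0 :: 'a \<Rightarrow>\<^sub>0 nat) = {TWord []}"
  proof (intro set_eqI iffI)
    fix w :: "'a tword" assume "w \<in> arrangements 0"
    then have "set (letters w) = {}" by (auto simp: arrangements_def count_list_0_iff)
    then show "w \<in> {TWord []}" by (cases w) simp
  qed (simp add: arrangements_def)
  moreover have "arrangements (Poly_Mapping.single j 1) = {TWord [j]}" for j :: 'a
  proof (intro set_eqI iffI)
    fix w :: "'a tword" assume "w \<in> arrangements (Poly_Mapping.single j 1)"
    then have "letters w = [j]"
      by (intro count_list_eq_singleton) (auto simp: arrangements_def lookup_single when_def)
    then show "w \<in> {TWord [j]}" by (cases w) simp
  qed (auto simp: arrangements_def lookup_single when_def)
  ultimately show ?thesis
    unfolding tens_op_symmetrize affine_poly_sum by simp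
qed

section \<open>Points and equations of the variety\<close>

definition pi0_symbol ::
  "nat \<Rightarrow> ('n::finite vec \<Rightarrow> nat \<Rightarrow> (nat \<Rightarrow> complex) \<Rightarrow> complex) \<Rightarrow>
   ('n vec \<Rightarrow> (nat \<Rightarrow> complex) \<Rightarrow> complex) \<Rightarrow> (nat \<Rightarrow> complex) \<Rightarrow> complex ^ 'n" where
  "pi0_symbol m a a0 v =
     (\<chi> i. (\<Sum>u<m. a (axis i 1) u (\<lambda>j. 0) * v u) + a0 (axis i 1) (\<lambda>j. 0))"

text \<open>Near \<open>t0\<close> a local exponential is a joint eigenfunction of the reduced
  operators, with the coordinates of the symbol as eigenvalues. It does not vanish at
  \<open>t0\<close>, so a polynomial that kills it vanishes at the symbol.\<close>

lemma pi0_symbol_in_char_variety: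
  assumes "K \<subseteq> Rm m" "\<rho> > 0" "t0 \<in> Rm m"
    and box: "\<And>t. \<lbrakk>t \<in> Rm m; \<And>u. u < m \<Longrightarrow> \<bar>t u - t0 u\<bar> < \<rho>\<rbrakk> \<Longrightarrow> t \<in> K"
  shows "pi0_symbol m a a0 v \<in> char_variety br m a a0 K"
proof -
  \<comment> \<open>Chosen so that \<open>\<i> * \<zeta> u = v u\<close>, which cancels the factor
    \<open>\<i>\<close> in the operators.\<close>
  define \<zeta> where "\<zeta> u = - \<i> * v u" for u
  let ?e = "\<lambda>t. exp (\<Sum>u<m. \<zeta> u * complex_of_real (t u))"
  obtain \<xi> r where \<xi>: "\<xi> \<in> CK m K" "r > 0"
    "\<And>t. \<lbrakk>t \<in> Rm m; \<And>u. u < m \<Longrightarrow> \<bar>t u - t0 u\<bar> < r\<rbrakk> \<Longrightarrow> \<xi> t = ?e t"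
    by (rule local_exponential_in_CK[OF assms(2,3) box, of \<zeta>]) blast+
  define l where "l i = pi0_symbol m a a0 v $ i" for i
  have ev: "foldr (pi0 m a a0) ws \<xi> t = prod_list (map l ws) * ?e t"
    if "t \<in> Rm m" "\<And>u. u < m \<Longrightarrow> \<bar>t u - t0 u\<bar> < r" for ws t
    using that
  proof (induction ws arbitrary: t)
    case Nil
    then show ?case using \<xi>(3) by simp
  next
    case (Cons i ws)
    have "pdiff u (foldr (pi0 m a a0) ws \<xi>) t = \<zeta> u * prod_list (map l ws) * ?e t" if "u < m" for u
      by (rule pdiff_local_exponential[OF Cons.IH Cons.prems that])
    then have "pi0 m a a0 i (foldr (pi0 m a a0) ws \<xi>) t =
        (\<Sum>u<m. \<i> * a (axis i 1) u (\<lambda>j. 0) * (\<zeta> u * prod_list (map l ws) * ?e t))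
        + a0 (axis i 1) (\<lambda>j. 0) * (prod_list (map l ws) * ?e t)"
      by (simp add: pi0_def first_order_op_def Cons)
    also have "\<dots> = l i * (prod_list (map l ws) * ?e t)"
    proof -
      have "\<i> * b * (\<zeta> u * c * e) = b * v u * (c * e)" for b c e u
        by (simp add: \<zeta>_def mult_ac)
      then show ?thesis by (simp only: l_def pi0_symbol_def vec_lambda_beta distrib_right sum_distrib_right)
    qed
    finally show ?case by (simp add: mult.assoc)
  qed
  have "sym_eval P (pi0_symbol m a a0 v) = 0" if "P \<in> classical_annihilator br m a a0 K" for P
  proof -
    have "tens_op (pi0 m a a0) (symmetrize P) \<xi> t0 = 0"
      using that \<xi>(1) classical_annihilator_iff[OF assms(1)] by blast
    moreover have "tens_op (pi0 m a a0) (symmetrize P) \<xi> t0 = sym_eval P (\<chi> i. l i) * ?e t0"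
      by (rule tens_op_symmetrize_eigen, rule ev) (use assms \<xi> in auto)
    ultimately show ?thesis by (simp add: l_def)
  qed
  then show ?thesis by (simp add: char_variety_def)
qed

text \<open>By \<open>lin\<close> the derivatives cancel in the combination of the reduced operators
  with coefficients \<open>x\<close>, and by \<open>const\<close> it is multiplication by
  \<open>c\<close>. Hence the linear form \<open>x\<close> minus \<open>c\<close> annihilates the
  module and vanishes on the variety.\<close>

lemma char_variety_affine_equation:
  assumes K: "K \<subseteq> Rm m" and z: "z \<in> char_variety br m a a0 K"
    and lin: "\<And>u. u < m \<Longrightarrow> (\<Sum>i\<in>UNIV. x i * a (axis i 1) u (\<lambda>j. 0)) = 0"
    and const: "(\<Sum>i\<in>UNIV. x i * a0 (axis i 1) (\<lambda>j. 0)) = c"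
  shows "(\<Sum>i\<in>UNIV. x i * z $ i) = c"
proof -
  have "tens_op (pi0 m a a0) (symmetrize (affine_poly x (- c))) F t = 0" for F t
  proof -
    have "(\<Sum>i\<in>UNIV. x i * pi0 m a a0 i F t) =
        (\<Sum>i\<in>UNIV. \<Sum>u<m. \<i> * pdiff u F t * (x i * a (axis i 1) u (\<lambda>j. 0)))
        + (\<Sum>i\<in>UNIV. x i * a0 (axis i 1) (\<lambda>j. 0)) * F t"
      by (simp add: pi0_def first_order_op_def distrib_left sum.distrib sum_distrib_left
          sum_distrib_right mult_ac)
    also have "(\<Sum>i\<in>UNIV. \<Sum>u<m. \<i> * pdiff u F t * (x i * a (axis i 1) u (\<lambda>j. 0))) =
        (\<Sum>u<m. \<i> * pdiff u F t * (\<Sum>i\<in>UNIV. x i * a (axis i 1) u (\<lambda>j. 0)))"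
      by (subst sum.swap) (simp add: sum_distrib_left)
    finally show ?thesis by (simp add: tens_op_symmetrize_affine_poly lin const)
  qed
  then have "affine_poly x (- c) \<in> classical_annihilator br m a a0 K"
    using classical_annihilator_iff[OF K] by blast
  then have "sym_eval (affine_poly x (- c)) z = 0" using z by (simp add: char_variety_def)
  then show ?thesis by (simp add: sym_eval_affine_poly)
qed

section \<open>Orbit and polarization\<close>

lemma exp_group_mul_differentiable:
  "exp_group br mul \<Longrightarrow> (\<lambda>z. mul (fst z) (snd z)) differentiable (at z)"
  unfolding exp_group_def smooth_def using diff_times.simps(2)[of 0] by blast

text \<open>\<open>Ad\<close> is defined by directional derivatives. As the group law is
  differentiable, so is conjugation, and these are the values of its total derivative; in particular
  \<open>Ad mul x\<close> is linear.\<close>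

lemma Ad_has_derivative:
  assumes G: "exp_group br mul"
  shows "((\<lambda>z. mul (mul x z) (- x)) has_derivative Ad mul x) (at 0)"
proof -
  let ?M = "\<lambda>z. mul (fst z) (snd z)"
  obtain D1 where D1: "(?M has_derivative D1) (at (x, 0))"
    using exp_group_mul_differentiable[OF G] unfolding differentiable_def by blast
  have "((\<lambda>z. ?M (x, z)) has_derivative (\<lambda>v. D1 (0, v))) (at 0)"
    by (rule has_derivative_compose[where f = "\<lambda>z. (x, z)"])
      (auto intro!: derivative_eq_intros has_derivative_Pair D1)
  then have m1: "((\<lambda>z. mul x z) has_derivative (\<lambda>v. D1 (0, v))) (at 0)" by simp
  obtain D2 where D2: "(?M has_derivative D2) (at (mul x 0, - x))"
    using exp_group_mul_differentiable[OF G] unfolding differentiable_def by blast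
  have "((\<lambda>z. ?M (mul x z, - x)) has_derivative (\<lambda>v. D2 (D1 (0, v), 0))) (at 0)"
    by (rule has_derivative_compose[where f = "\<lambda>z. (mul x z, - x)"])
      (auto intro!: has_derivative_Pair m1 D2)
  then have D: "((\<lambda>z. mul (mul x z) (- x)) has_derivative (\<lambda>v. D2 (D1 (0, v), 0))) (at 0)"
    (is "(?c has_derivative ?D) _") by simp
  have "Ad mul x v = ?D v" for v
  proof -
    have "((\<lambda>t. ?c (t *\<^sub>R v)) has_derivative (\<lambda>t. ?D (t *\<^sub>R v))) (at (0::real))"
      by (rule has_derivative_compose[where f = "\<lambda>t. t *\<^sub>R v"])
        (use D in \<open>auto intro!: derivative_eq_intros\<close>)
    moreover have "(\<lambda>t. ?D (t *\<^sub>R v)) = (\<lambda>t. t *\<^sub>R ?D v)"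
      by (rule ext, rule linear_cmul[OF has_derivative_linear[OF D]])
    ultimately have "((\<lambda>t. ?c (t *\<^sub>R v)) has_vector_derivative ?D v) (at 0)"
      by (simp add: has_vector_derivative_def)
    then show ?thesis unfolding Ad_def by (rule vector_derivative_at)
  qed
  then have "Ad mul x = ?D" by blast
  with D show ?thesis by simp
qed

lemma Ad_bounded_linear: "exp_group br mul \<Longrightarrow> bounded_linear (Ad mul x)"
  using Ad_has_derivative has_derivative_bounded_linear by blast

lemma coad_apply: "exp_group br mul \<Longrightarrow> coad mul x \<eta> y = \<eta> (Ad mul (- x) y)"
  by (simp add: coad_def bounded_linear_Blinfun_apply Ad_bounded_linear)

text \<open>Conjugations by points of one line compose by associativity, and the chain rule at the
  common fixed point 0 passes this on to \<open>Ad\<close>.\<close>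

lemma Ad_add:
  assumes G: "exp_group br mul"
  shows "Ad mul ((s + t) *\<^sub>R x) y = Ad mul (s *\<^sub>R x) (Ad mul (t *\<^sub>R x) y)"
proof -
  let ?c = "\<lambda>x z. mul (mul x z) (- x)"
  have assoc: "\<And>x y z. mul (mul x y) z = mul x (mul y z)"
    and unit: "\<And>x. mul 0 x = x" "\<And>x. mul x 0 = x" "\<And>x. mul x (- x) = 0"
    and line: "\<And>s t x. mul (s *\<^sub>R x) (t *\<^sub>R x) = (s + t) *\<^sub>R x"
    using G unfolding exp_group_def by blast+
  have c0: "?c x 0 = 0" for x by (simp add: unit)
  have neg: "- ((s + t) *\<^sub>R x) = mul (- (t *\<^sub>R x)) (- (s *\<^sub>R x))"
    using line[of "- t" x "- s"] by (simp add: algebra_simps)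
  have "?c ((s + t) *\<^sub>R x) z = ?c (s *\<^sub>R x) (?c (t *\<^sub>R x) z)" for z
    unfolding neg unfolding line[symmetric] by (simp only: assoc)
  then have eq: "?c ((s + t) *\<^sub>R x) = (\<lambda>z. ?c (s *\<^sub>R x) (?c (t *\<^sub>R x) z))" by blast
  have "((\<lambda>z. ?c (s *\<^sub>R x) (?c (t *\<^sub>R x) z)) has_derivative
      (\<lambda>v. Ad mul (s *\<^sub>R x) (Ad mul (t *\<^sub>R x) v))) (at 0)"
    by (rule has_derivative_compose[OF Ad_has_derivative[OF G]])
      (use Ad_has_derivative[OF G] in \<open>simp add: c0\<close>)
  then have "(?c ((s + t) *\<^sub>R x) has_derivative
      (\<lambda>v. Ad mul (s *\<^sub>R x) (Ad mul (t *\<^sub>R x) v))) (at 0)" by (simp only: eq)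
  from has_derivative_unique[OF Ad_has_derivative[OF G] this]
  show ?thesis by (rule fun_cong)
qed

text \<open>The additivity of \<open>Ad\<close> along a line translates the derivative at 0, known
  from \<open>exp_group\<close>, to every \<open>s\<close>.\<close>

lemma Ad_line_has_vector_derivative:
  assumes G: "exp_group br mul"
  shows "((\<lambda>s. Ad mul (s *\<^sub>R x) y) has_vector_derivative br x (Ad mul (s *\<^sub>R x) y)) (at s)"
proof -
  \<comment> \<open>The point 0 is written \<open>s - s\<close> to fit the chain rule for the shift
    \<open>r - s\<close>.\<close>
  have "((\<lambda>r. Ad mul (r *\<^sub>R x) (Ad mul (s *\<^sub>R x) y)) has_vector_derivative
      br x (Ad mul (s *\<^sub>R x) y)) (at (s - s))"
    using G unfolding exp_group_def by simp
  moreover have "((\<lambda>r. r - s) has_vector_derivative 1) (at s)"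
    by (auto intro!: derivative_eq_intros)
  ultimately have "((\<lambda>r. Ad mul ((r - s) *\<^sub>R x) (Ad mul (s *\<^sub>R x) y)) has_vector_derivative
      br x (Ad mul (s *\<^sub>R x) y)) (at s)"
    using vector_diff_chain_at[of "\<lambda>r. r - s" 1 s] by (fastforce simp: o_def)
  then show ?thesis by (simp add: Ad_add[OF G, symmetric])
qed

text \<open>
  All derivatives of \<open>s \<mapsto> \<eta> (Ad (s x) y)\<close> vanish at \<open>0\<close>, and the remainder in Taylor's formula tends to
  \<open>0\<close> because \<open>Ad (s x) y\<close> solves \<open>\<phi>' = [x, \<phi>]\<close>.
\<close>

lemma functional_Ad_line:
  fixes \<eta> :: "real ^ 'n \<Rightarrow> real"
  assumes G: "exp_group br mul" and br: "bounded_linear (br x)" and \<eta>: "bounded_linear \<eta>"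
    and zero: "\<And>k. \<eta> ((br x ^^ Suc k) y) = 0"
  shows "\<eta> (Ad mul (s *\<^sub>R x) y) = \<eta> y"
proof -
  define \<phi> where "\<phi> = (\<lambda>s. Ad mul (s *\<^sub>R x) y)"
  have d\<phi>: "(\<phi> has_vector_derivative br x (\<phi> s)) (at s)" for s
    unfolding \<phi>_def by (rule Ad_line_has_vector_derivative[OF G])
  have "Ad mul 0 y = y"
  proof -
    have "(\<lambda>t. mul (mul 0 (t *\<^sub>R y)) (- 0)) = (\<lambda>t. t *\<^sub>R y)"
      using G unfolding exp_group_def by simp
    moreover have "((\<lambda>t. t *\<^sub>R y) has_vector_derivative y) (at 0)"
      by (auto intro!: derivative_eq_intros)
    ultimately show ?thesis unfolding Ad_def by (simp add: vector_derivative_at)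
  qed
  then have \<phi>0: "\<phi> 0 = y" by (simp add: \<phi>_def)
  have bl: "bounded_linear (\<lambda>v. (br x ^^ n) v)" for n
  proof (induction n)
    case (Suc n)
    then show ?case using bounded_linear_compose[OF br] by (simp add: o_def)
  qed (simp add: id_def)
  \<comment> \<open>Each differentiation inserts one more \<open>br x\<close>, so \<open>D n\<close>
    is the derivative of order \<open>n\<close> of \<open>\<eta> (\<phi> s)\<close>.\<close>
  define D where "D n s = \<eta> ((br x ^^ n) (\<phi> s))" for n s
  have dD: "(D n has_real_derivative D (Suc n) s) (at s)" for n s
  proof -
    have "((\<lambda>s. \<eta> ((br x ^^ n) (\<phi> s))) has_vector_derivative \<eta> ((br x ^^ n) (br x (\<phi> s)))) (at s)"
      by (rule bounded_linear.has_vector_derivative[OF bounded_linear_compose[OF \<eta> bl] d\<phi>])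
    then show ?thesis
      by (simp add: D_def[abs_def] has_real_derivative_iff_has_vector_derivative funpow_swap1)
  qed
  obtain c where c: "c > 0" "\<And>v. norm (br x v) \<le> norm v * c"
    using bounded_linear.pos_bounded[OF br] by blast
  obtain b where b: "b > 0" "\<And>v. \<bar>\<eta> v\<bar> \<le> norm v * b"
    using bounded_linear.pos_bounded[OF \<eta>] by auto
  have "continuous_on {- \<bar>s\<bar>..\<bar>s\<bar>} \<phi>"
    by (rule continuous_at_imp_continuous_on) (use d\<phi> has_vector_derivative_continuous in blast)
  then have "compact (\<phi> ` {- \<bar>s\<bar>..\<bar>s\<bar>})" by (intro compact_continuous_image) auto
  then obtain M where M: "\<And>r. \<bar>r\<bar> \<le> \<bar>s\<bar> \<Longrightarrow> norm (\<phi> r) \<le> M"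
    using compact_imp_bounded bounded_iff by (metis abs_le_iff atLeastAtMost_iff imageI minus_le_iff)
  have iter: "norm ((br x ^^ n) v) \<le> norm v * c ^ n" for n v
  proof (induction n)
    case (Suc n)
    have "norm ((br x ^^ Suc n) v) \<le> norm ((br x ^^ n) v) * c" using c(2) by simp
    also have "\<dots> \<le> norm v * c ^ n * c" using Suc c(1) by (intro mult_right_mono) auto
    finally show ?case by (simp add: mult_ac)
  qed simp
  \<comment> \<open>Taylor terms of positive order vanish by \<open>zero\<close>; the remainder is
    estimated by the norm bound \<open>c\<close> for \<open>br x\<close> and the bound
    \<open>M\<close> for \<open>\<phi>\<close> between \<open>- \<bar>s\<bar>\<close> and
    \<open>\<bar>s\<bar>\<close>.\<close>
  have bound: "\<bar>\<eta> (\<phi> s) - \<eta> y\<bar> \<le> M * b * ((c * \<bar>s\<bar>) ^ Suc n / fact (Suc n))" for n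
  proof -
    obtain t where t: "\<bar>t\<bar> \<le> \<bar>s\<bar>"
      "D 0 s = (\<Sum>k<Suc n. D k 0 / fact k * s ^ k) + D (Suc n) t / fact (Suc n) * s ^ Suc n"
      using Maclaurin_all_le[of D "D 0" s "Suc n"] dD by blast
    have "(\<Sum>k<Suc n. D k 0 / fact k * s ^ k) = D 0 0"
      unfolding sum.lessThan_Suc_shift using zero by (simp add: D_def \<phi>0)
    with t(2) have "\<eta> (\<phi> s) - \<eta> y = D (Suc n) t / fact (Suc n) * s ^ Suc n"
      by (simp add: D_def \<phi>0)
    then have "\<bar>\<eta> (\<phi> s) - \<eta> y\<bar> = \<bar>D (Suc n) t\<bar> * (\<bar>s\<bar> ^ Suc n / fact (Suc n))"
      by (simp add: abs_mult power_abs)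
    also have "\<dots> \<le> (M * c ^ Suc n * b) * (\<bar>s\<bar> ^ Suc n / fact (Suc n))"
    proof -
      have "\<bar>D (Suc n) t\<bar> \<le> norm ((br x ^^ Suc n) (\<phi> t)) * b" unfolding D_def by (rule b)
      also have "\<dots> \<le> norm (\<phi> t) * c ^ Suc n * b" by (rule mult_right_mono[OF iter]) (use b in simp)
      also have "\<dots> \<le> M * c ^ Suc n * b" using M[OF t(1)] b c by (intro mult_right_mono) auto
      finally show ?thesis by (rule mult_right_mono) simp
    qed
    finally show ?thesis by (simp only: power_mult_distrib times_divide_eq_right mult_ac)
  qed
  have "(\<lambda>n. (c * \<bar>s\<bar>) ^ n / fact n) \<longlonglongrightarrow> 0"
    using summable_LIMSEQ_zero[OF summable_exp[of "c * \<bar>s\<bar>"]] by (simp add: field_simps)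
  then have "(\<lambda>n. M * b * ((c * \<bar>s\<bar>) ^ Suc n / fact (Suc n))) \<longlonglongrightarrow> M * b * 0"
    by (intro tendsto_mult_left LIMSEQ_Suc)
  then have "\<bar>\<eta> (\<phi> s) - \<eta> y\<bar> \<le> 0"
    using bound by (intro LIMSEQ_le_const) auto
  then show ?thesis by (simp add: \<phi>_def)
qed

text \<open>This is the inclusion of \<open>H.f\<close> in \<open>f\<close> plus the annihilator of
  \<open>h\<close>. Iterated brackets with \<open>- x\<close> keep \<open>y\<close> in
  \<open>h\<close>, and \<open>f\<close> kills brackets of elements of \<open>h\<close>, so all
  derivatives along the line vanish.\<close>

lemma coad_polarization_eq:
  assumes E: "exponential_solvable br mul" and P: "real_polarization br f h"
    and x: "x \<in> h" and y: "y \<in> h"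
  shows "coad mul x f y = f y"
proof -
  have G: "exp_group br mul" and L: "lie_algebra br"
    using E by (auto simp: exponential_solvable_def)
  have lin: "bounded_linear (br x)" for x
    using L by (simp add: lie_algebra_def bilinear_def linear_conv_bounded_linear)
  have hs: "subspace h" "\<And>x y. x \<in> h \<Longrightarrow> y \<in> h \<Longrightarrow> br x y \<in> h"
    "\<And>x y. x \<in> h \<Longrightarrow> y \<in> h \<Longrightarrow> f (br x y) = 0"
    using P by (auto simp: real_polarization_def)
  have x': "- x \<in> h" using x hs(1) by (simp add: subspace_neg)
  have "(br (- x) ^^ k) y \<in> h" for k
    by (induction k) (simp_all add: y hs(2) x')
  then have "f ((br (- x) ^^ Suc k) y) = 0" for k using hs(3)[OF x'] by simp
  from functional_Ad_line[OF G lin blinfun.bounded_linear_right this, of 1]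
  show ?thesis by (simp add: coad_apply[OF G])
qed

section \<open>Boxes, orbit dimension and linear forms\<close>

lemma openin_Euclidean_space_box:
  assumes "openin (Euclidean_space m) U" "w \<in> U"
  obtains e where "e > 0" "\<And>v. \<lbrakk>v \<in> Rm m; \<And>u. u < m \<Longrightarrow> \<bar>v u - w u\<bar> < e\<rbrakk> \<Longrightarrow> v \<in> U"
proof -
  obtain S where S: "open S" "U = S \<inter> Rm m"
    using assms(1) unfolding Euclidean_space_def openin_subtopology
    by (auto simp: euclidean_product_topology)
  obtain X where X: "w \<in> Pi\<^sub>E UNIV X" "\<And>i. open (X i)" "Pi\<^sub>E UNIV X \<subseteq> S"
    using product_topology_open_contains_basis[of "\<lambda>_. euclidean" UNIV S w] S assms(2)
    by (auto simp: euclidean_product_topology)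
  have "\<exists>e>0. ball (w i) e \<subseteq> X i" for i
  proof -
    have "w i \<in> X i" using X(1) by (simp add: PiE_iff)
    then show ?thesis using X(2)[of i] unfolding open_contains_ball by blast
  qed
  then obtain r where r: "\<And>i. r i > 0" "\<And>i. ball (w i) (r i) \<subseteq> X i" by metis
  \<comment> \<open>Only the first \<open>m\<close> coordinates restrict the radius, since all later
    ones are 0. The element 1 keeps the set nonempty when \<open>m = 0\<close>.\<close>
  define e where "e = Min (insert 1 (r ` {..<m}))"
  show ?thesis
  proof
    show "e > 0" unfolding e_def using r by (subst Min_gr_iff) auto
    fix v assume v: "v \<in> Rm m" "\<And>u. u < m \<Longrightarrow> \<bar>v u - w u\<bar> < e"
    have "v i \<in> ball (w i) (r i)" for i
    proof (cases "i < m")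
      case True
      then have "e \<le> r i" by (simp add: e_def)
      with v(2)[OF True] show ?thesis by (simp add: dist_real_def abs_minus_commute)
    next
      case False
      then have "v i = w i" using v(1) assms(2) S by (simp add: topspace_Euclidean_space)
      then show ?thesis using r by simp
    qed
    then have "v i \<in> X i" for i using r(2) by blast
    then have "v \<in> Pi\<^sub>E UNIV X" by (simp add: PiE_iff)
    then show "v \<in> U" using X S v(1) by blast
  qed
qed

text \<open>Rank and nullity of the map sending \<open>x\<close> to the functional
  \<open>f (br x y)\<close> of \<open>y\<close>, whose kernel is the stabilizer: on the orthogonal
  complement of the kernel the map is injective with the same image.\<close>

lemma orbit_dim_eq:
  fixes f :: "'n::finite dual"
  assumes "lie_algebra br"
  shows "orbit_dim br f + dim (stabilizer br f) = dim (UNIV :: (real ^ 'n) set)"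
proof -
  have bil: "bilinear br" using assms by (simp add: lie_algebra_def)
  have lin: "bounded_linear (br x)" for x
    using bil by (simp add: bilinear_def linear_conv_bounded_linear)
  define T where "T = (\<lambda>x. f o\<^sub>L Blinfun (br x))"
  have T: "T x y = f (br x y)" for x y by (simp add: T_def bounded_linear_Blinfun_apply[OF lin])
  have linT: "linear T"
    by (rule linearI; rule blinfun_eqI)
      (simp_all add: T bilinear_ladd[OF bil] bilinear_lmul[OF bil] blinfun.add_right
        blinfun.scaleR_right blinfun.add_left blinfun.scaleR_left)
  have ker: "stabilizer br f = {x. T x = 0}"
    by (auto simp: stabilizer_def T[symmetric] intro: blinfun_eqI)
  have sub: "subspace (stabilizer br f)"
    unfolding ker by (rule linear_subspace_kernel[OF linT])
  let ?V = "{y. \<forall>x \<in> stabilizer br f. orthogonal x y}"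
  have V: "subspace ?V" by (rule subspace_orthogonal_to_vectors)
  have "inj_on T (span ?V)"
    unfolding span_eq_iff[THEN iffD2, OF V]
  proof (rule inj_onI)
    fix u v assume uv: "u \<in> ?V" "v \<in> ?V" "T u = T v"
    then have "u - v \<in> stabilizer br f" by (simp add: ker linear_diff[OF linT])
    moreover have "u - v \<in> ?V" using uv V subspace_diff by blast
    ultimately have "orthogonal (u - v) (u - v)" by blast
    then show "u = v" by (simp add: orthogonal_self)
  qed
  then have "dim (T ` ?V) = dim ?V" by (rule eucl.dim_image_eq[OF linT])
  moreover have "T ` ?V = range T"
  proof (intro equalityI subsetI)
    fix z assume "z \<in> range T"
    then obtain x where x: "z = T x" by blast
    obtain y v where yv: "y \<in> span (stabilizer br f)"
      "\<And>w. w \<in> span (stabilizer br f) \<Longrightarrow> orthogonal v w" "x = y + v"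
      using orthogonal_subspace_decomp_exists by blast
    have "T y = 0" using yv(1) sub ker by (simp add: span_eq_iff[THEN iffD2])
    then have "z = T v" by (simp add: x yv(3) linear_add[OF linT])
    moreover have "v \<in> ?V" using yv(2) span_base orthogonal_commute by blast
    ultimately show "z \<in> T ` ?V" by blast
  qed auto
  ultimately have "orbit_dim br f = dim ?V" by (simp add: orbit_dim_def T_def)
  then show "orbit_dim br f + dim (stabilizer br f) = dim (UNIV :: (real ^ 'n) set)"
    using dim_subspace_orthogonal_to_vectors[OF sub subspace_UNIV] by simp
qed

text \<open>Moving a single coordinate by \<open>e / 2\<close> stays in the box and isolates a
  single coefficient.\<close>

lemma affine_const_on_box:
  fixes c :: "nat \<Rightarrow> complex"
  assumes "e > 0" "w \<in> Rm m"
    and const: "\<And>v. \<lbrakk>v \<in> Rm m; \<And>u. u < m \<Longrightarrow> \<bar>v u - w u\<bar> < e\<rbrakk> \<Longrightarrow>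
      (\<Sum>u<m. c u * complex_of_real (v u)) = k"
    and i: "i < m"
  shows "c i = 0"
proof -
  let ?v = "w(i := w i + e / 2)"
  have "?v \<in> Rm m" using assms(2) i by (simp only: Rm_upd)
  then have "(\<Sum>u<m. c u * complex_of_real (?v u)) = k"
    by (rule const) (use assms(1) in auto)
  moreover have "(\<Sum>u<m. c u * complex_of_real (w u)) = k"
    by (rule const) (use assms in auto)
  ultimately have "(\<Sum>u<m. c u * complex_of_real (?v u) - c u * complex_of_real (w u)) = 0"
    by (simp only: sum_subtractf) simp
  also have "(\<Sum>u<m. c u * complex_of_real (?v u) - c u * complex_of_real (w u)) =
      (\<Sum>u<m. if u = i then c u * complex_of_real (e / 2) else 0)"
    by (rule sum.cong) (auto simp: algebra_simps)
  finally show ?thesis using i assms(1) by simp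
qed

lemma blinfun_eq_sum_axis:
  fixes \<eta> :: "'n::finite dual"
  shows "\<eta> x = (\<Sum>i\<in>UNIV. x $ i * \<eta> (axis i 1))"
proof -
  have "\<eta> x = \<eta> (\<Sum>i\<in>UNIV. x $ i *\<^sub>R axis i 1)"
    using basis_expansion[of x] by (simp add: scalar_mult_eq_scaleR)
  then show ?thesis by (simp add: blinfun.sum_right blinfun.scaleR_right)
qed

text \<open>A point with \<open>q = 0\<close> projects to the coset of the identity, because
  \<open>coexp_map\<close> sends the origin to \<open>h\<close>. It is therefore moved from
  \<open>f\<close> by an element of \<open>h\<close> and agrees with \<open>f\<close> there. At
  \<open>q = 0\<close> the coordinate formula is affine in the momenta.\<close>

lemma pedersen_fibre:
  assumes E: "exponential_solvable br mul" and P: "real_polarization br f h"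
    and C: "pedersen_coords mul br f h m X p W a a0" and w: "w \<in> W"
  obtains \<eta> where "\<eta> \<in> coad_orbit mul f"
    "pq_map m p (q_coord mul f h m X) \<eta> = (w, \<lambda>_. 0)" "\<And>x. x \<in> h \<Longrightarrow> \<eta> x = f x"
    "\<And>x. complex_of_real (\<eta> x) = (\<Sum>u<m. a x u (\<lambda>_. 0) * complex_of_real (w u)) + a0 x (\<lambda>_. 0)"
proof -
  let ?q = "q_coord mul f h m X"
  have zero: "(\<lambda>_. 0) \<in> Rm m" by (simp add: topspace_Euclidean_space)
  have bij: "bij_betw (pq_map m p ?q) (coad_orbit mul f) (W \<times> Rm m)"
    using C by (simp add: pedersen_coords_def darboux_chart_def)
  then obtain \<eta> where \<eta>: "\<eta> \<in> coad_orbit mul f" "pq_map m p ?q \<eta> = (w, \<lambda>_. 0)"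
    using w zero unfolding bij_betw_def by (metis (no_types, lifting) SigmaI imageE)
  have q: "?q \<eta> = (\<lambda>_. 0)" and pw: "\<And>u. u < m \<Longrightarrow> p u \<eta> = w u"
    using \<eta>(2) by (simp_all add: pq_map_def fun_eq_iff) (metis)
  \<comment> \<open>The choice made in \<open>orbit_proj\<close>, so that \<open>\<eta>\<close>
    projects to the coset of \<open>x0\<close>.\<close>
  define x0 where "x0 = (SOME x. coad mul x f = \<eta>)"
  have x0: "coad mul x0 f = \<eta>"
    using \<eta>(1) unfolding x0_def coad_orbit_def by (metis (mono_tags, lifting) rangeE someI)
  have unit: "mul 0 x = x" "mul x 0 = x" for x
    using E by (auto simp: exponential_solvable_def exp_group_def)
  have h0: "0 \<in> h" using P by (simp add: real_polarization_def subspace_0)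
  have "lcoset mul h x0 \<in> coexp_map mul h m X ` Rm m"
    using C by (auto simp: pedersen_coords_def coexponential_basis_def bij_betw_def)
  then have "coexp_map mul h m X (?q \<eta>) = lcoset mul h x0"
    unfolding q_coord_def coexp_coord_def orbit_proj_def x0_def[symmetric] by (rule f_inv_into_f)
  moreover have "coexp_map mul h m X (\<lambda>_. 0) = h"
  proof -
    have "foldl mul 0 (map (\<lambda>i. 0) is) = 0" for "is" :: "nat list"
      by (induction "is") (simp_all add: unit)
    then show ?thesis by (simp add: coexp_map_def lcoset_def unit)
  qed
  ultimately have "lcoset mul h x0 = h" by (simp add: q)
  moreover have "x0 \<in> lcoset mul h x0"
    unfolding lcoset_def by (rule image_eqI[OF _ h0]) (simp add: unit)
  ultimately have "x0 \<in> h" by simp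
  show ?thesis
  proof
    show "\<eta> x = f x" if "x \<in> h" for x
      using coad_polarization_eq[OF E P \<open>x0 \<in> h\<close> that] by (simp add: x0)
    have "\<forall>x. complex_of_real (blinfun_apply \<eta> x) =
        (\<Sum>u<m. a x u (\<lambda>j. complex_of_real (?q \<eta> j)) * complex_of_real (p u \<eta>))
        + a0 x (\<lambda>j. complex_of_real (?q \<eta> j))"
      using C \<eta>(1) unfolding pedersen_coords_def by blast
    then show "complex_of_real (\<eta> x) =
        (\<Sum>u<m. a x u (\<lambda>_. 0) * complex_of_real (w u)) + a0 x (\<lambda>_. 0)" for x
      by (simp add: q pw)
  qed (use \<eta> in auto)
qed

section \<open>Identification of the variety\<close>

theorem mainTheorem8:
  fixes br :: "real ^ 'n \<Rightarrow> real ^ 'n \<Rightarrow> real ^ 'n"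
    and mul :: "real ^ 'n \<Rightarrow> real ^ 'n \<Rightarrow> real ^ 'n"
    and f :: "(real ^ 'n) \<Rightarrow>\<^sub>L real"
    and h :: "(real ^ 'n) set"
    and d m :: nat
    and K W :: "(nat \<Rightarrow> real) set"
    and X :: "nat \<Rightarrow> real ^ 'n"
    and p :: "nat \<Rightarrow> ((real ^ 'n) \<Rightarrow>\<^sub>L real) \<Rightarrow> real"
    and a :: "real ^ 'n \<Rightarrow> nat \<Rightarrow> (nat \<Rightarrow> complex) \<Rightarrow> complex"
    and a0 :: "real ^ 'n \<Rightarrow> (nat \<Rightarrow> complex) \<Rightarrow> complex"
  assumes "exponential_solvable br mul"
    and "real_polarization br f h"
    and "d = orbit_dim br f" and "m = d div 2"
    and "compactin (Euclidean_space m) K" and "Euclidean_space m interior_of K \<noteq> {}"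
    and "pedersen_coords mul br f h m X p W a a0"
  shows "real_points (char_variety br m a a0 K) = (\<lambda>\<eta>. f + \<eta>) ` annih h \<and>
    ((\<lambda>x. coad mul x f) ` h = (\<lambda>\<eta>. f + \<eta>) ` annih h \<longrightarrow>
      real_points (char_variety br m a a0 K) = (\<lambda>x. coad mul x f) ` h)"
proof -
  note fibre = pedersen_fibre[OF assms(1,2,7)]
  have sub: "subspace h" using assms(2) by (simp add: real_polarization_def)
  have K: "K \<subseteq> Rm m" using assms(5) by (rule compactin_subset_topspace)
  obtain t0 where "t0 \<in> Euclidean_space m interior_of K" using assms(6) by blast
  then obtain \<rho> where \<rho>: "\<rho> > 0"
    "\<And>t. \<lbrakk>t \<in> Rm m; \<And>u. u < m \<Longrightarrow> \<bar>t u - t0 u\<bar> < \<rho>\<rbrakk> \<Longrightarrow> t \<in> K"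
    using openin_Euclidean_space_box[OF openin_interior_of] interior_of_subset by (metis subsetD)
  have t0: "t0 \<in> Rm m"
    using \<open>t0 \<in> _\<close> interior_of_subset_topspace[of "Euclidean_space m" K] by blast

  \<comment> \<open>The orbit points with \<open>q = 0\<close>\<close>
  have chart: "openin (Euclidean_space m) W"
      "bij_betw (pq_map m p (q_coord mul f h m X)) (coad_orbit mul f) (W \<times> Rm m)"
    using assms(7) by (auto simp: pedersen_coords_def darboux_chart_def)
  \<comment> \<open>The orbit is nonempty, hence so is \<open>W\<close>.\<close>
  have "coad mul 0 f \<in> coad_orbit mul f" by (simp add: coad_orbit_def)
  then obtain w where w: "w \<in> W" using chart(2) bij_betwE by fastforce
  have WR: "W \<subseteq> Rm m" using chart(1) openin_subset by blast
  obtain e where e: "e > 0" "\<And>v. \<lbrakk>v \<in> Rm m; \<And>u. u < m \<Longrightarrow> \<bar>v u - w u\<bar> < e\<rbrakk> \<Longrightarrow> v \<in> W"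
    using openin_Euclidean_space_box[OF chart(1) w] by blast
  define A where "A i u = a (axis i 1) u (\<lambda>_. 0)" for i :: 'n and u
  define B where "B i = a0 (axis i 1) (\<lambda>_. 0)" for i :: 'n
  have fib: "\<exists>\<eta> :: 'n dual. \<eta> \<in> coad_orbit mul f \<and> pq_map m p (q_coord mul f h m X) \<eta> = (v, \<lambda>_. 0) \<and>
      (\<forall>x\<in>h. \<eta> x = f x) \<and>
      (\<forall>i. complex_of_real (\<eta> (axis i 1)) = (\<Sum>u<m. A i u * complex_of_real (v u)) + B i)"
    if v: "v \<in> W" for v
  proof -
    obtain \<eta> :: "'n dual" where "\<eta> \<in> coad_orbit mul f" "pq_map m p (q_coord mul f h m X) \<eta> = (v, \<lambda>_. 0)"
      "\<And>x. x \<in> h \<Longrightarrow> \<eta> x = f x" "\<And>x. complex_of_real (\<eta> x) =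
        (\<Sum>u<m. a x u (\<lambda>_. 0) * complex_of_real (v u)) + a0 x (\<lambda>_. 0)"
      by (rule fibre[OF v]) blast
    then show ?thesis unfolding A_def B_def by blast
  qed

  \<comment> \<open>For \<open>x\<close> in \<open>h\<close> the value \<open>\<eta> x\<close> is
    \<open>f x\<close> whatever the momenta \<open>v\<close>, so the linear part in \<open>v\<close>
    is constant on a box and its coefficients vanish.\<close>
  have lin: "(\<Sum>i\<in>UNIV. complex_of_real (x $ i) * A i u) = 0" if "x \<in> h" "u < m" for x u
  proof (rule affine_const_on_box[OF e(1) _ _ that(2)])
    show "w \<in> Rm m" using w WR by blast
    fix v assume "v \<in> Rm m" "\<And>u. u < m \<Longrightarrow> \<bar>v u - w u\<bar> < e"
    then have "v \<in> W" by (rule e(2))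
    from fib[OF this] obtain \<eta> :: "'n dual" where \<eta>: "\<eta> x = f x"
      "\<And>i. complex_of_real (\<eta> (axis i 1)) = (\<Sum>u<m. A i u * complex_of_real (v u)) + B i"
      using \<open>x \<in> h\<close> by blast
    have "complex_of_real (f x) = (\<Sum>i\<in>UNIV. complex_of_real (x $ i) * complex_of_real (\<eta> (axis i 1)))"
      unfolding \<eta>(1)[symmetric] blinfun_eq_sum_axis[of \<eta> x] by simp
    also have "\<dots> = (\<Sum>i\<in>UNIV. \<Sum>u<m. complex_of_real (x $ i) * A i u * complex_of_real (v u))
        + (\<Sum>i\<in>UNIV. complex_of_real (x $ i) * B i)"
      by (simp add: \<eta>(2) distrib_left sum.distrib sum_distrib_left mult.assoc)
    also have "(\<Sum>i\<in>UNIV. \<Sum>u<m. complex_of_real (x $ i) * A i u * complex_of_real (v u)) =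
        (\<Sum>u<m. (\<Sum>i\<in>UNIV. complex_of_real (x $ i) * A i u) * complex_of_real (v u))"
      by (subst sum.swap) (simp add: sum_distrib_right)
    finally show "(\<Sum>u<m. (\<Sum>i\<in>UNIV. complex_of_real (x $ i) * A i u) * complex_of_real (v u)) =
        complex_of_real (f x) - (\<Sum>i\<in>UNIV. complex_of_real (x $ i) * B i)"
      by simp
  qed

  obtain \<eta>0 :: "'n dual" where \<eta>0: "\<And>x. x \<in> h \<Longrightarrow> \<eta>0 x = f x"
      "\<And>i. complex_of_real (\<eta>0 (axis i 1)) = (\<Sum>u<m. A i u * complex_of_real (w u)) + B i"
    using fib[OF w] by blast

  \<comment> \<open>With the linear part gone, the constant part alone gives
    \<open>f x\<close>.\<close>
  have const: "(\<Sum>i\<in>UNIV. complex_of_real (x $ i) * B i) = complex_of_real (f x)" if "x \<in> h" for x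
  proof -
    have "complex_of_real (f x) = (\<Sum>i\<in>UNIV. complex_of_real (x $ i) * complex_of_real (\<eta>0 (axis i 1)))"
      unfolding \<eta>0(1)[OF that, symmetric] blinfun_eq_sum_axis[of \<eta>0 x] by simp
    also have "\<dots> = (\<Sum>i\<in>UNIV. \<Sum>u<m. complex_of_real (x $ i) * A i u * complex_of_real (w u))
        + (\<Sum>i\<in>UNIV. complex_of_real (x $ i) * B i)"
      by (simp add: \<eta>0(2) distrib_left sum.distrib sum_distrib_left mult.assoc)
    also have "(\<Sum>i\<in>UNIV. \<Sum>u<m. complex_of_real (x $ i) * A i u * complex_of_real (w u)) =
        (\<Sum>u<m. (\<Sum>i\<in>UNIV. complex_of_real (x $ i) * A i u) * complex_of_real (w u))"
      by (subst sum.swap) (simp add: sum_distrib_right)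
    finally show ?thesis by (simp add: lin[OF that])
  qed

  \<comment> \<open>The coordinates of orbit points are real, so the imaginary parts of
    \<open>A\<close> form a linear form in \<open>v\<close> with the constant value
    \<open>- Im (B i)\<close> on the box.\<close>
  have real: "complex_of_real (Re (A i u)) = A i u" if "u < m" for i u
  proof -
    have "complex_of_real (Im (A i u)) = 0"
    proof (rule affine_const_on_box[OF e(1) _ _ that])
      show "w \<in> Rm m" using w WR by blast
      fix v assume "v \<in> Rm m" "\<And>u. u < m \<Longrightarrow> \<bar>v u - w u\<bar> < e"
      then have "v \<in> W" by (rule e(2))
      from fib[OF this] obtain \<eta> :: "'n dual" where
        "complex_of_real (\<eta> (axis i 1)) = (\<Sum>u<m. A i u * complex_of_real (v u)) + B i"
        by blast
      from arg_cong[OF this, of Im] have "(\<Sum>u<m. Im (A i u) * v u) = - Im (B i)"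
        by simp
      then show "(\<Sum>u<m. complex_of_real (Im (A i u)) * complex_of_real (v u)) =
          complex_of_real (- Im (B i))"
        by (metis (no_types, lifting) of_real_mult of_real_sum sum.cong)
    qed
    then show ?thesis by (simp add: complex_eq_iff)
  qed

  define c where "c u = (\<chi> i. Re (A i u))" for u
  \<comment> \<open>A relation between the columns would allow the momenta to move from
    \<open>w\<close> to another \<open>v\<close> in \<open>W\<close> without changing the point of
    the dual; but the momenta are functions of that point.\<close>
  have indep: "k u = 0" if k: "(\<Sum>u<m. k u *\<^sub>R c u) = 0" and u: "u < m" for k u
  proof -
    \<comment> \<open>\<open>M\<close> exceeds every \<open>\<bar>k u\<bar>\<close>, so a shift by
      \<open>e / M * k u\<close> stays in the box; the summand 1 keeps \<open>M\<close>
      positive.\<close>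
    define M where "M = 1 + (\<Sum>u<m. \<bar>k u\<bar>)"
    have M: "M > 0" "\<And>u. u < m \<Longrightarrow> \<bar>k u\<bar> < M"
    proof -
      show "M > 0" unfolding M_def by (simp add: add_pos_nonneg sum_nonneg)
      show "\<bar>k u\<bar> < M" if "u < m" for u
        using member_le_sum[of u "{..<m}" "\<lambda>u. \<bar>k u\<bar>"] that by (simp add: M_def)
    qed
    define v where "v u = (if u < m then w u + e / M * k u else 0)" for u
    have "v \<in> W"
    proof (rule e(2))
      show "v \<in> Rm m" by (simp add: v_def topspace_Euclidean_space)
      show "\<bar>v u - w u\<bar> < e" if "u < m" for u
        using M(2)[OF that] M(1) e(1) that by (simp add: v_def abs_mult field_simps)
    qed
    from fib[OF w] obtain \<eta> :: "'n dual" where \<eta>: "\<eta> \<in> coad_orbit mul f"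
      "pq_map m p (q_coord mul f h m X) \<eta> = (w, \<lambda>_. 0)"
      "\<And>i. complex_of_real (\<eta> (axis i 1)) = (\<Sum>u<m. A i u * complex_of_real (w u)) + B i"
      by blast
    from fib[OF \<open>v \<in> W\<close>] obtain \<eta>' :: "'n dual" where \<eta>': "\<eta>' \<in> coad_orbit mul f"
      "pq_map m p (q_coord mul f h m X) \<eta>' = (v, \<lambda>_. 0)"
      "\<And>i. complex_of_real (\<eta>' (axis i 1)) = (\<Sum>u<m. A i u * complex_of_real (v u)) + B i"
      by blast
    have "\<eta>' (axis i 1) = \<eta> (axis i 1)" for i
    proof -
      have "(\<Sum>u<m. k u * Re (A i u)) = 0"
        using arg_cong[OF k, of "\<lambda>x. x $ i"] by (simp add: c_def sum_component)
      then have "(\<Sum>u<m. complex_of_real (k u) * complex_of_real (Re (A i u))) = 0"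
        by (simp flip: of_real_mult of_real_sum)
      then have "(\<Sum>u<m. complex_of_real (e / M) * (complex_of_real (k u) * A i u)) = 0"
        by (simp add: real sum_distrib_left[symmetric] del: of_real_divide)
      moreover have "(\<Sum>u<m. A i u * complex_of_real (v u)) = (\<Sum>u<m. A i u * complex_of_real (w u))
          + (\<Sum>u<m. complex_of_real (e / M) * (complex_of_real (k u) * A i u))"
        by (simp add: v_def distrib_left sum.distrib mult_ac)
      ultimately have "complex_of_real (\<eta>' (axis i 1)) = complex_of_real (\<eta> (axis i 1))"
        using \<eta>(3) \<eta>'(3) by simp
      then show ?thesis by simp
    qed
    then have "\<eta>' = \<eta>"
      by (intro blinfun_eqI) (subst (1 2) blinfun_eq_sum_axis, simp)
    with \<eta>(2) \<eta>'(2) have "v = w" by simp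
    then have "e / M * k u = 0" using u by (metis add_cancel_left_right v_def)
    then show ?thesis using e M by simp
  qed

  \<comment> \<open>A basis of the annihilator\<close>
  have cinj: "inj_on c {..<m}"
  proof (rule inj_onI, rule ccontr)
    fix u v assume uv: "u \<in> {..<m}" "v \<in> {..<m}" "c u = c v" "u \<noteq> v"
    \<comment> \<open>Coefficients 1 and - 1 on two equal columns would be a nontrivial
      relation.\<close>
    define k where "k r = (if r = u then 1 else 0) - (if r = v then 1 else (0::real))" for r
    have "(\<Sum>r<m. k r *\<^sub>R c r) = (\<Sum>r<m. (if r = u then c r else 0) - (if r = v then c r else 0))"
      by (rule sum.cong) (auto simp: k_def)
    also have "\<dots> = 0" using uv by (simp add: sum_subtractf)
    finally have "k u = 0" using indep uv by blast
    with uv show False by (simp add: k_def)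
  qed
  have cindep: "independent (c ` {..<m})"
  proof
    assume "dependent (c ` {..<m})"
    then obtain k where k: "\<exists>v\<in>c ` {..<m}. k v \<noteq> 0" "(\<Sum>v\<in>c ` {..<m}. k v *\<^sub>R v) = 0"
      by (auto simp: real_vector.dependent_finite)
    have "(\<Sum>u<m. k (c u) *\<^sub>R c u) = 0"
      using k(2) by (simp add: sum.reindex[OF cinj])
    then show False using k(1) indep[of "\<lambda>u. k (c u)"] by blast
  qed
  \<comment> \<open>The inner product identifies this space with \<open>annih h\<close>.\<close>
  let ?V = "{y. \<forall>x\<in>h. orthogonal x y}"
  have cV: "c ` {..<m} \<subseteq> ?V"
  proof clarify
    fix u x assume "u < m" "x \<in> h"
    from arg_cong[OF lin[OF this(2,1)], of Re]
    show "orthogonal x (c u)" by (simp add: orthogonal_def inner_vec_def c_def)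
  qed
  \<comment> \<open>The polarization condition gives \<open>2 * dim ?V = d\<close>; so
    \<open>d\<close> is even and the division by 2 is exact.\<close>
  have "dim ?V = m"
  proof -
    have "lie_algebra br" using assms(1) by (simp add: exponential_solvable_def)
    from orbit_dim_eq[OF this, of f] assms(3)
    have "d + dim (stabilizer br f) = dim (UNIV :: (real ^ 'n) set)" by simp
    moreover have "2 * dim h = dim (UNIV :: (real ^ 'n) set) + dim (stabilizer br f)"
      using assms(2) by (simp add: real_polarization_def)
    moreover have "dim ?V + dim h = dim (UNIV :: (real ^ 'n) set)"
      using dim_subspace_orthogonal_to_vectors[OF sub subspace_UNIV] by simp
    ultimately show ?thesis using assms(4) by linarith
  qed
  then have span: "?V \<subseteq> span (c ` {..<m})"
    by (intro card_ge_dim_independent cV cindep) (simp add: card_image[OF cinj])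

  \<comment> \<open>The two inclusions\<close>
  have "real_points (char_variety br m a a0 K) = (\<lambda>\<eta>. f + \<eta>) ` annih h"
  proof (intro equalityI subsetI)
    fix \<eta> :: "'n dual" assume "\<eta> \<in> real_points (char_variety br m a a0 K)"
    then have z: "(\<chi> i. complex_of_real (\<eta> (axis i 1))) \<in> char_variety br m a a0 K"
      by (simp add: real_points_def)
    \<comment> \<open>Each \<open>x\<close> in \<open>h\<close> contributes an affine equation of
      the variety with right-hand side \<open>f x\<close>.\<close>
    have "\<eta> x = f x" if "x \<in> h" for x
    proof -
      have "(\<Sum>i\<in>UNIV. complex_of_real (x $ i) * (\<chi> i. complex_of_real (\<eta> (axis i 1))) $ i) =
          complex_of_real (f x)"
        by (rule char_variety_affine_equation[OF K z])
          (use lin[OF that] const[OF that] in \<open>simp_all add: A_def B_def\<close>)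
      then have "complex_of_real (\<eta> x) = complex_of_real (f x)"
        by (simp add: blinfun_eq_sum_axis[of \<eta> x])
      then show ?thesis by simp
    qed
    then have "\<eta> - f \<in> annih h" by (simp add: annih_def blinfun.diff_left)
    then show "\<eta> \<in> (\<lambda>\<eta>. f + \<eta>) ` annih h" by (rule rev_image_eqI) simp
  next
    fix \<eta> :: "'n dual" assume "\<eta> \<in> (\<lambda>\<eta>. f + \<eta>) ` annih h"
    then have \<eta>: "\<eta> x = f x" if "x \<in> h" for x
      using that by (auto simp: annih_def blinfun.add_left)
    \<comment> \<open>The difference of \<open>\<eta>\<close> and the fibre point
      \<open>\<eta>0\<close> vanishes on \<open>h\<close>, so it is a combination of the columns of
      \<open>A\<close>.\<close>
    define y where "y = (\<chi> i. \<eta> (axis i 1) - \<eta>0 (axis i 1))"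
    have "x \<bullet> y = \<eta> x - \<eta>0 x" for x
      unfolding blinfun_eq_sum_axis[of \<eta> x] blinfun_eq_sum_axis[of \<eta>0 x]
      by (simp add: inner_vec_def y_def right_diff_distrib sum_subtractf)
    then have "y \<in> ?V" using \<eta> \<eta>0(1) by (simp add: orthogonal_def)
    then have "y \<in> span (c ` {..<m})" using span by blast
    then obtain k where "y = (\<Sum>v\<in>c ` {..<m}. k v *\<^sub>R v)"
      by (auto simp: real_vector.span_finite)
    then have y: "y = (\<Sum>u<m. k (c u) *\<^sub>R c u)" by (simp add: sum.reindex[OF cinj])
    \<comment> \<open>Shifting the momenta of \<open>\<eta>0\<close> by the coefficients of that
      combination makes \<open>\<eta>\<close> the symbol at \<open>v\<close>. The shifted momenta
      may leave \<open>W\<close>: the symbols at all \<open>v\<close> lie in the variety.\<close>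
    define v where "v u = complex_of_real (w u + k (c u))" for u
    have "complex_of_real (\<eta> (axis i 1)) = (\<Sum>u<m. A i u * v u) + B i" for i
    proof -
      have "\<eta> (axis i 1) - \<eta>0 (axis i 1) = (\<Sum>u<m. k (c u) * Re (A i u))"
        using arg_cong[OF y, of "\<lambda>x. x $ i"] by (simp add: y_def c_def sum_component)
      then have "complex_of_real (\<eta> (axis i 1)) = complex_of_real (\<eta>0 (axis i 1))
          + (\<Sum>u<m. complex_of_real (k (c u)) * complex_of_real (Re (A i u)))"
        by (simp flip: of_real_mult of_real_sum of_real_add)
      also have "\<dots> = (\<Sum>u<m. A i u * v u) + B i"
        by (simp add: real \<eta>0(2) v_def distrib_left sum.distrib mult_ac)
      finally show ?thesis .
    qed
    then have "(\<chi> i. complex_of_real (\<eta> (axis i 1))) = pi0_symbol m a a0 v"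
      by (simp add: pi0_symbol_def A_def B_def)
    then show "\<eta> \<in> real_points (char_variety br m a a0 K)"
      using pi0_symbol_in_char_variety[OF K \<rho>(1) t0 \<rho>(2)] by (simp add: real_points_def)
  qed
  then show ?thesis by simp
qed

end
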